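(* Let $$\mathcal{M}(n)=\frac12\prod_{\substack{p\equiv3\ (\mathrm{mod}\ 4)\\ p\le n}}(1+p^{-1})^{-1},\qquad \mathcal{L}(n)=\frac{\beta}{\sqrt{\log n}},$$ where $\beta=\frac{1}{\sqrt2}\prod_{p\equiv3\ (\mathrm{mod}\ 4)}(1-p^{-2})^{-1/2}$ is the Landau–Ramanujan constant. Then $y(n)=\mathcal{M}(n)/\mathcal{L}(n)$ converges as $n\to\infty$ and $$\lim_{n\to\infty}\frac{\mathcal{M}(n)}{\mathcal{L}(n)}=\frac12\sqrt{\frac{\pi}{e^{\gamma}}},$$ where $\gamma$ is Euler's constant.
   Context: $p$ ranges over primes. $\mathcal{M}(n)=\prod_{p\le n}Med(p)$ is the product of the limiting densities of elements representable as a sum of two squares in $\mathbb{Z}/p^k\mathbb{Z}$ ($k\to\infty$). *)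

theory Defs
  imports "HOL-Analysis.Analysis" "HOL-Computational_Algebra.Primes"
begin

definition calM :: "nat \<Rightarrow> real" where
  "calM n = (1/2) * (\<Prod>p\<in>{p. prime p \<and> p mod 4 = 3 \<and> p \<le> n}. inverse (1 + 1 / real p))"

definition LR_beta :: real where
  "LR_beta = (1 / sqrt 2) *
     (\<Prod>k. if prime k \<and> k mod 4 = 3 then (1 - 1 / (real k)^2) powr (-1/2) else 1)"

definition calL :: "nat \<Rightarrow> real" where
  "calL n = LR_beta / sqrt (ln (real n))"

end

theory Submission
  imports Defs "HOL-Number_Theory.Prime_Powers" "HOL-Real_Asymp.Real_Asymp"
begin

text \<open>
  Write \<open>q n\<close> for the indicator of the primes congruent to 3 mod 4 and
  \<open>g x = ln ((1 + x) / (1 - x))\<close>. Since \<open>(1 + x)\<^sup>2 = (1 - x\<^sup>2) exp (g x)\<close>, the claim amounts to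
  \<open>(\<Sum>n\<le>N. q n * g (1/n)) - ln (ln N) \<longlonglongrightarrow> \<gamma> + ln (2/\<pi>)\<close>.
  Chebyshev's bound, Mertens' method for the trivial and the nontrivial character mod 4, and
  \<open>L(1, \<chi>) = \<pi>/4 \<noteq> 0\<close> give \<open>(\<Sum>n\<le>N. 2 * q n * ln n / n) = ln N + O(1)\<close>, so partial
  summation shows that the limit exists. It is identified by letting \<open>s\<close> decrease to 1 in
  \<open>(\<Sum>n. q n * g (n powr -s)) = ln (\<zeta>(s) (1 - 2 powr -s) / L(s, \<chi>))\<close>.
  No Gamma integral is needed for the constant \<open>\<gamma>\<close>: grouping the \<open>n\<close> into the blocks
  \<open>2^k < n \<le> 2^(k+1)\<close> turns the comparison with \<open>ln (ln N)\<close> into a comparison with harmonic numbers,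
  to which Abel's limit theorem for power series applies.
\<close>

subsection \<open>Partial summation and Abelian limits\<close>

text \<open>Abel summation: the partial sums of \<open>c\<close> get multiplied by the decrements
  \<open>w k - w (Suc k)\<close>, which are nonnegative and telescope, together with the boundary
  term \<open>w n\<close>, to \<open>w m\<close>.\<close>

lemma sum_mult_antimono_bound:
  fixes c w :: "nat \<Rightarrow> real"
  assumes bound: "\<And>j. \<bar>\<Sum>k\<in>{m..<j}. c k\<bar> \<le> B"
    and anti: "\<And>k. k \<ge> m \<Longrightarrow> w (Suc k) \<le> w k" and nonneg: "\<And>k. k \<ge> m \<Longrightarrow> w k \<ge> 0"
  shows "\<bar>\<Sum>k\<in>{m..<n}. c k * w k\<bar> \<le> B * w m"
proof (cases "m \<le> n")
  case True
  define S where "S = (\<lambda>j. \<Sum>k\<in>{m..<j}. c k)"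
  have B: "B \<ge> 0" using bound[of m] by simp
  have "(\<Sum>k\<in>{m..<n}. c k * w k) = S n * w n + (\<Sum>k\<in>{m..<n}. S (Suc k) * (w k - w (Suc k)))"
    using True
  proof (induction n rule: dec_induct)
    case base
    then show ?case by (simp add: S_def)
  next
    case (step n)
    then have "S (Suc n) = S n + c n" by (simp add: S_def)
    with step show ?case by (simp add: algebra_simps)
  qed
  also have "\<bar>\<dots>\<bar> \<le> \<bar>S n * w n\<bar> + (\<Sum>k\<in>{m..<n}. \<bar>S (Suc k) * (w k - w (Suc k))\<bar>)"
    by (rule order.trans[OF abs_triangle_ineq add_left_mono[OF sum_abs]])
  also have "\<dots> \<le> B * w n + (\<Sum>k\<in>{m..<n}. B * (w k - w (Suc k)))"
  proof (intro add_mono sum_mono)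
    have S: "\<bar>S j\<bar> \<le> B" for j using bound unfolding S_def .
    show "\<bar>S n * w n\<bar> \<le> B * w n"
      unfolding abs_mult using S[of n] nonneg[OF True] by (simp add: mult_right_mono)
    show "\<bar>S (Suc k) * (w k - w (Suc k))\<bar> \<le> B * (w k - w (Suc k))" if "k \<in> {m..<n}" for k
      unfolding abs_mult using S[of "Suc k"] anti[of k] that by (simp add: mult_right_mono)
  qed
  also have "(\<Sum>k\<in>{m..<n}. B * (w k - w (Suc k))) = B * (w m - w n)"
    using sum_Suc_diff'[OF True, of "\<lambda>k. - w k"] unfolding sum_distrib_left[symmetric] by simp
  finally show ?thesis by (simp add: algebra_simps)
next
  case False
  then show ?thesis using bound[of m] nonneg[of m] by simp
qed

text \<open>Dirichlet's test with an explicit remainder. The factor 2 arises because a block sum of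
  \<open>c\<close> is a difference of two initial sums, each bounded by \<open>B\<close>.\<close>

lemma summable_mult_antimono:
  fixes c w :: "nat \<Rightarrow> real"
  assumes bound: "\<And>j. \<bar>\<Sum>k<j. c k\<bar> \<le> B"
    and anti: "\<And>k. w (Suc k) \<le> w k" and nonneg: "\<And>k. w k \<ge> 0" and lim: "w \<longlonglongrightarrow> 0"
  shows "summable (\<lambda>k. c k * w k)"
    and "\<bar>(\<Sum>k. c k * w k) - (\<Sum>k<m. c k * w k)\<bar> \<le> 2 * B * w m"
proof -
  have b2: "\<bar>\<Sum>k\<in>{m..<j}. c k\<bar> \<le> 2 * B" for m j
  proof (cases "m \<le> j")
    case True
    then have "(\<Sum>k\<in>{m..<j}. c k) = (\<Sum>k<j. c k) - (\<Sum>k<m. c k)"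
      by (metis atLeast0LessThan sum_diff_nat_ivl zero_le)
    then show ?thesis using bound[of j] bound[of m] by linarith
  next
    case False
    then show ?thesis using bound[of 0] by simp
  qed
  have tail: "\<bar>\<Sum>k\<in>{m..<n}. c k * w k\<bar> \<le> 2 * B * w m" for m n
    by (rule sum_mult_antimono_bound[OF b2]) (use anti nonneg in auto)
  have lim2: "(\<lambda>m. 2 * B * w (Suc m)) \<longlonglongrightarrow> 0"
    using tendsto_mult_left[OF LIMSEQ_Suc[OF lim], of "2 * B"] by simp
  show sm: "summable (\<lambda>k. c k * w k)"
  proof (rule summable_bounded_partials[OF _ lim2])
    have "norm (\<Sum>k\<in>{a<..b}. c k * w k) \<le> 2 * B * w (Suc a)" for a b
    proof -
      have "{a<..b} = {Suc a..<Suc b}" by auto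
      then show ?thesis using tail[where m="Suc a" and n="Suc b"] by (simp only: real_norm_def)
    qed
    then show "\<forall>\<^sub>F x0 in sequentially. \<forall>a\<ge>x0. \<forall>b>a.
        norm (\<Sum>k\<in>{a<..b}. c k * w k) \<le> 2 * B * w (Suc a)" by simp
  qed
  have "(\<lambda>n. \<bar>(\<Sum>k<n. c k * w k) - (\<Sum>k<m. c k * w k)\<bar>) \<longlonglongrightarrow>
      \<bar>(\<Sum>k. c k * w k) - (\<Sum>k<m. c k * w k)\<bar>"
    by (intro tendsto_intros summable_LIMSEQ sm)
  moreover have "\<forall>\<^sub>F n in sequentially. \<bar>(\<Sum>k<n. c k * w k) - (\<Sum>k<m. c k * w k)\<bar> \<le> 2 * B * w m"
    using eventually_ge_at_top[of m]
  proof eventually_elim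
    case (elim n)
    then have "(\<Sum>k<n. c k * w k) - (\<Sum>k<m. c k * w k) = (\<Sum>k\<in>{m..<n}. c k * w k)"
      by (metis atLeast0LessThan sum_diff_nat_ivl zero_le)
    then show ?case using tail[where m=m and n=n] by simp
  qed
  ultimately show "\<bar>(\<Sum>k. c k * w k) - (\<Sum>k<m. c k * w k)\<bar> \<le> 2 * B * w m"
    by (rule tendsto_upperbound) simp
qed

text \<open>Abel's limit theorem for arbitrary decreasing weights, applied later both to
  \<open>r ^ Suc k\<close> and to \<open>real (Suc k) powr - \<delta>\<close>. The Cauchy criterion
  for \<open>c\<close> and summation by parts bound the tails uniformly in \<open>x\<close>; the
  finite head converges term by term.\<close>

lemma abel_limit:
  fixes c :: "nat \<Rightarrow> real" and w :: "'a \<Rightarrow> nat \<Rightarrow> real"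
  assumes c: "summable c"
    and w: "\<forall>\<^sub>F x in F. antimono (w x) \<and> (\<forall>k. 0 \<le> w x k \<and> w x k \<le> 1) \<and> summable (\<lambda>k. c k * w x k)"
    and lim: "\<And>k. ((\<lambda>x. w x k) \<longlongrightarrow> 1) F"
  shows "((\<lambda>x. \<Sum>k. c k * w x k) \<longlongrightarrow> suminf c) F"
proof (rule tendstoI)
  fix e :: real assume e: "e > 0"
  \<comment> \<open>Three errors are added below: the weighted tail, the change of the head, and the
    tail of \<open>c\<close>. Each is at most \<open>d\<close>.\<close>
  define d where "d = e / 4"
  have d: "d > 0" using e by (simp add: d_def)
  obtain m where m: "\<And>n j. n \<ge> m \<Longrightarrow> \<bar>\<Sum>k\<in>{n..<j}. c k\<bar> < d"
    using c d unfolding summable_Cauchy real_norm_def by meson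
  have ct: "\<bar>suminf c - (\<Sum>k<m. c k)\<bar> \<le> d"
  proof (rule tendsto_upperbound)
    show "(\<lambda>n. \<bar>(\<Sum>k<n. c k) - (\<Sum>k<m. c k)\<bar>) \<longlonglongrightarrow> \<bar>suminf c - (\<Sum>k<m. c k)\<bar>"
      by (intro tendsto_intros summable_LIMSEQ c)
    show "\<forall>\<^sub>F n in sequentially. \<bar>(\<Sum>k<n. c k) - (\<Sum>k<m. c k)\<bar> \<le> d"
      using eventually_ge_at_top[of m]
    proof eventually_elim
      case (elim n)
      then have "(\<Sum>k<n. c k) - (\<Sum>k<m. c k) = (\<Sum>k\<in>{m..<n}. c k)"
        by (metis atLeast0LessThan sum_diff_nat_ivl zero_le)
      then show ?case using m[of m n] by simp
    qed
  qed simp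
  have "((\<lambda>x. \<Sum>k<m. c k * w x k) \<longlongrightarrow> (\<Sum>k<m. c k * 1)) F"
    by (intro tendsto_intros lim)
  then have "\<forall>\<^sub>F x in F. dist (\<Sum>k<m. c k * w x k) (\<Sum>k<m. c k * 1) < d"
    using d by (rule tendstoD)
  with w show "\<forall>\<^sub>F x in F. dist (\<Sum>k. c k * w x k) (suminf c) < e"
  proof eventually_elim
    case (elim x)
    have "\<bar>(\<Sum>k. c k * w x k) - (\<Sum>k<m. c k * w x k)\<bar> \<le> d"
    proof (rule tendsto_upperbound)
      show "(\<lambda>n. \<bar>(\<Sum>k<n. c k * w x k) - (\<Sum>k<m. c k * w x k)\<bar>)
          \<longlonglongrightarrow> \<bar>(\<Sum>k. c k * w x k) - (\<Sum>k<m. c k * w x k)\<bar>"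
        using elim by (intro tendsto_intros summable_LIMSEQ) auto
      show "\<forall>\<^sub>F n in sequentially. \<bar>(\<Sum>k<n. c k * w x k) - (\<Sum>k<m. c k * w x k)\<bar> \<le> d"
        using eventually_ge_at_top[of m]
      proof eventually_elim
        case (elim n)
        then have "(\<Sum>k<n. c k * w x k) - (\<Sum>k<m. c k * w x k) = (\<Sum>k\<in>{m..<n}. c k * w x k)"
          by (metis atLeast0LessThan sum_diff_nat_ivl zero_le)
        moreover have "\<bar>\<Sum>k\<in>{m..<n}. c k * w x k\<bar> \<le> d * w x m"
          using \<open>antimono (w x) \<and> _\<close> m[of m]
          by (intro sum_mult_antimono_bound) (auto intro: less_imp_le simp: antimono_def)
        moreover have "d * w x m \<le> d * 1"
          using \<open>antimono (w x) \<and> _\<close> d by (intro mult_left_mono) auto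
        ultimately show ?case by simp
      qed
    qed simp
    moreover have "\<bar>(\<Sum>k<m. c k * w x k) - (\<Sum>k<m. c k)\<bar> < d"
      using elim by (simp add: dist_real_def)
    ultimately show ?case using ct e unfolding dist_real_def d_def by linarith
  qed
qed

subsection \<open>The character mod 4 and the von Mangoldt function\<close>

definition chi4 :: "nat \<Rightarrow> real" where
  "chi4 n = (if n mod 4 = 1 then 1 else if n mod 4 = 3 then -1 else 0)"

lemma chi4_0 [simp]: "chi4 0 = 0" and chi4_1 [simp]: "chi4 (Suc 0) = 1"
  by (simp_all add: chi4_def)

lemma abs_chi4_le: "\<bar>chi4 n\<bar> \<le> 1"
  by (simp add: chi4_def)

lemma chi4_mult: "chi4 (a * b) = chi4 a * chi4 b"
proof -
  have a: "a mod 4 = 0 \<or> a mod 4 = 1 \<or> a mod 4 = 2 \<or> a mod 4 = 3"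
    and b: "b mod 4 = 0 \<or> b mod 4 = 1 \<or> b mod 4 = 2 \<or> b mod 4 = 3" by presburger+
  have "(a * b) mod 4 = ((a mod 4) * (b mod 4)) mod 4" by (simp add: mod_mult_eq)
  then show ?thesis using a b unfolding chi4_def by (elim disjE) simp_all
qed

lemma sum_chi4: "(\<Sum>k<n. chi4 (Suc k)) = (if n mod 4 = 1 \<or> n mod 4 = 2 then 1 else 0)"
proof (induction n)
  case (Suc n)
  have "n mod 4 = 0 \<or> n mod 4 = 1 \<or> n mod 4 = 2 \<or> n mod 4 = 3" by presburger
  then show ?case using Suc by (elim disjE) (simp_all add: chi4_def mod_Suc)
qed simp

lemma abs_sum_chi4_le: "\<bar>\<Sum>k<n. chi4 (Suc k)\<bar> \<le> 1"
  by (simp add: sum_chi4)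

text \<open>Leibniz's series for \<open>pi / 4\<close> with the vanishing even terms inserted. The
  value supplies both the nonvanishing of L(1, \<open>chi4\<close>) and the \<open>pi\<close> in the
  final constant.\<close>

lemma chi4_over_n_sums: "(\<lambda>k. chi4 (Suc k) * (1 / Suc k)) sums (pi / 4)"
proof -
  have odd: "chi4 (Suc (2 * k)) = (-1) ^ k" for k
  proof (cases "even k")
    case True
    then obtain j where "k = 2 * j" by (elim evenE)
    then have "Suc (2 * k) = 4 * j + 1" by simp
    then have "Suc (2 * k) mod 4 = 1" by presburger
    then show ?thesis using True by (simp add: chi4_def)
  next
    case False
    then obtain j where "k = 2 * j + 1" by (elim oddE)
    then have "Suc (2 * k) = 4 * j + 3" by simp
    then have "Suc (2 * k) mod 4 = 3" by presburger
    then show ?thesis using False by (simp add: chi4_def)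
  qed
  have "summable (\<lambda>k. (-1) ^ k * (1 / real (k * 2 + 1) * 1 ^ (k * 2 + 1)))"
    by (rule summable_arctan_series) simp_all
  then have "(\<lambda>k. (-1) ^ k / real (k * 2 + 1)) sums (pi / 4)"
    using pi_series by (simp add: sums_iff)
  then have "(\<lambda>k. chi4 (Suc (2 * k)) * (1 / Suc (2 * k))) sums (pi / 4)"
    unfolding odd by (simp add: mult.commute)
  then show ?thesis
  proof (subst (asm) sums_mono_reindex[of "\<lambda>k. 2 * k" "\<lambda>k. chi4 (Suc k) * (1 / Suc k)"])
    show "strict_mono (\<lambda>k::nat. 2 * k)" by (auto simp: strict_mono_def)
    fix k :: nat assume "k \<notin> range (\<lambda>k. 2 * k)"
    then have "odd k" by (auto elim: evenE)
    then have "Suc k mod 4 = 0 \<or> Suc k mod 4 = 2" by presburger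
    then show "chi4 (Suc k) * (1 / Suc k) = 0" by (auto simp: chi4_def)
  qed auto
qed

text \<open>The decay rate is what matters: for \<open>M = N div d\<close> the bound is at most
  \<open>2 * d / N\<close>, which cancels the weight \<open>1 / d\<close> in the divisor sums and
  leaves a Chebyshev sum.\<close>

lemma chi4_over_n_tail: "\<bar>pi / 4 - (\<Sum>m\<in>{1..M}. chi4 m / m)\<bar> \<le> 2 / (M + 1)"
proof -
  have "\<bar>(\<Sum>k. chi4 (Suc k) * (1 / Suc k)) - (\<Sum>k<M. chi4 (Suc k) * (1 / Suc k))\<bar>
      \<le> 2 * 1 * (1 / Suc M)"
  proof (rule summable_mult_antimono(2))
    show "(\<lambda>k. 1 / real (Suc k)) \<longlonglongrightarrow> 0" by real_asymp
  qed (use abs_sum_chi4_le in \<open>auto simp: field_simps\<close>)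
  moreover have "(\<Sum>k<M. chi4 (Suc k) * (1 / Suc k)) = (\<Sum>m\<in>{1..M}. chi4 m / m)"
    by (simp add: sum.atLeast1_atMost_eq)
  ultimately show ?thesis
    using chi4_over_n_sums[THEN sums_unique] by (simp only: of_nat_Suc add.commute mult_1_right times_divide_eq_right)
qed

text \<open>The derivative of ln x / x changes sign at e, so monotonicity is claimed only from 3
  on.\<close>

lemma ln_over_n_antimono:
  assumes "3 \<le> m" "m \<le> n"
  shows "ln (real n) / n \<le> ln (real m) / m"
proof (rule DERIV_nonpos_imp_nonincreasing[of "real m" "real n" "\<lambda>x. ln x / x"])
  fix x :: real assume x: "real m \<le> x" "x \<le> real n"
  with assms have x3: "x \<ge> 3" by simp
  have "exp 1 \<le> x" using exp_le x3 by linarith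
  then have "1 \<le> ln x" using x3 by (simp add: ln_ge_iff)
  moreover have "((\<lambda>x. ln x / x) has_real_derivative (1 / x * x - ln x * 1) / (x * x)) (at x)"
    using x3 by (auto intro!: derivative_eq_intros)
  ultimately show "\<exists>y. ((\<lambda>x. ln x / x) has_real_derivative y) (at x) \<and> y \<le> 0"
    using x3 by (intro exI[of _ "(1 / x * x - ln x * 1) / (x * x)"])
      (auto intro!: divide_nonpos_pos)
qed (use assms in auto)

text \<open>The terms at 1 and 2 vanish, so summation by parts can start at 3, where the weights
  \<open>ln n / n\<close> decrease.\<close>

lemma abs_sum_chi4_ln_le: "\<bar>\<Sum>n\<in>{1..N}. chi4 n * ln n / n\<bar> \<le> ln 3"
proof -
  define c where "c = (\<lambda>k. chi4 (k + 3))"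
  have b: "\<bar>\<Sum>k\<in>{0..<j}. c k\<bar> \<le> 1" for j
  proof -
    \<comment> \<open>The subtracted 1 is \<open>chi4 1 + chi4 2\<close>, the part of the full
      character sum that the shift by 3 drops.\<close>
    have "(\<Sum>k<j. c k) = (\<Sum>k<j + 2. chi4 (Suc k)) - 1"
    proof (induction j)
      case 0
      show ?case using sum_chi4[of 2] by (simp only: lessThan_0 sum.empty add_0) simp
    next
      case (Suc j)
      then show ?case by (simp add: c_def numeral_3_eq_3)
    qed
    then show ?thesis by (simp add: sum_chi4 atLeast0LessThan)
  qed
  have "\<bar>\<Sum>k\<in>{0..<N - 2}. c k * (ln (real (k + 3)) / (k + 3))\<bar> \<le> 1 * (ln (real (0 + 3)) / real (0 + 3))"
    proof (rule sum_mult_antimono_bound[OF b])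
    fix k :: nat
    show "ln (real (Suc k + 3)) / real (Suc k + 3) \<le> ln (real (k + 3)) / real (k + 3)"
      by (rule ln_over_n_antimono) auto
  qed auto
  moreover have "(\<Sum>n\<in>{1..N}. chi4 n * ln n / n) = (\<Sum>k\<in>{0..<N - 2}. c k * (ln (real (k + 3)) / (k + 3)))"
  proof -
    have "(\<Sum>n\<in>{1..N}. chi4 n * ln n / n) = (\<Sum>n\<in>{3..<N+1}. chi4 n * ln n / n)"
    proof (rule sum.mono_neutral_right)
      show "\<forall>n\<in>{1..N} - {3..<N+1}. chi4 n * ln n / n = 0"
      proof
        fix n assume "n \<in> {1..N} - {3..<N+1}"
        then have "n = 1 \<or> n = 2" by auto
        then show "chi4 n * ln n / n = 0" by (auto simp: chi4_def)
      qed
    qed auto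
    also have "\<dots> = (\<Sum>k\<in>{0..<N - 2}. c k * (ln (real (k + 3)) / (k + 3)))"
      by (rule sum.reindex_bij_witness[of _ "\<lambda>k. k + 3" "\<lambda>n. n - 3"]) (auto simp: c_def)
    finally show ?thesis .
  qed
  moreover have "ln (3::real) / 3 \<le> ln 3" by simp
  ultimately show ?thesis by simp
qed

section \<open>Divisor sums and Chebyshev's bound\<close>

lemma sum_divisors_swap:
  fixes F :: "nat \<Rightarrow> nat \<Rightarrow> 'a :: comm_monoid_add"
  shows "(\<Sum>n\<in>{1..N}. \<Sum>d | d dvd n. F d (n div d)) = (\<Sum>d\<in>{1..N}. \<Sum>m\<in>{1..N div d}. F d m)"
proof -
  have fin: "finite {d. d dvd n}" if "n \<in> {1..N}" for n using that by (intro finite_divisors_nat) auto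
  have le: "b \<le> N" if "0 < k" "b * k \<le> N" for b k
    using mult_le_mono2[of 1 k b] that by linarith
  have "(\<Sum>n\<in>{1..N}. \<Sum>d | d dvd n. F d (n div d))
      = (\<Sum>(n, d)\<in>(SIGMA n:{1..N}. {d. d dvd n}). F d (n div d))"
    using fin by (intro sum.Sigma) auto
  \<comment> \<open>Both sides enumerate the pairs with \<open>d * m \<le> N\<close>, once by the
    product and once by the first factor.\<close>
  also have "\<dots> = (\<Sum>(d, m)\<in>(SIGMA d:{1..N}. {1..N div d}). F d m)"
    by (rule sum.reindex_bij_witness[of _ "\<lambda>(d, m). (d * m, d)" "\<lambda>(n, d). (d, n div d)"])
      (auto simp: less_eq_div_iff_mult_less_eq mult.commute div_le_mono Suc_le_eq
         elim!: dvdE dest: dvd_imp_le intro: le)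
  also have "\<dots> = (\<Sum>d\<in>{1..N}. \<Sum>m\<in>{1..N div d}. F d m)"
    by (intro sum.Sigma[symmetric]) auto
  finally show ?thesis .
qed

text \<open>Legendre's formula in von Mangoldt form: \<open>ln n\<close> is the sum of
  \<open>mangoldt\<close> over the divisors of \<open>n\<close>, and \<open>d\<close> has
  \<open>N div d\<close> multiples up to \<open>N\<close>.\<close>

lemma ln_fact_eq_sum_mangoldt: "ln (fact N) = (\<Sum>d\<in>{1..N}. mangoldt d * real (N div d))"
proof -
  have "ln (fact N :: real) = (\<Sum>n\<in>{1..N}. ln (real n))"
    unfolding fact_prod of_nat_prod by (subst ln_prod) auto
  also have "\<dots> = (\<Sum>n\<in>{1..N}. \<Sum>d | d dvd n. mangoldt d)"
    by (intro sum.cong refl) (simp add: mangoldt_sum)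
  also have "\<dots> = (\<Sum>d\<in>{1..N}. \<Sum>m\<in>{1..N div d}. mangoldt d)"
    by (rule sum_divisors_swap)
  finally show ?thesis by (simp add: mult.commute)
qed


text \<open>Chebyshev's argument: in the expansion of the logarithm of the central binomial
  coefficient, \<open>mangoldt d\<close> has the coefficient
  \<open>2 * n div d - 2 * (n div d)\<close>. It is never negative and equals 1 on the block, while
  the coefficient itself is at most \<open>2 ^ (2 * n)\<close>.\<close>

lemma sum_mangoldt_dyadic: "(\<Sum>d\<in>{n<..2*n}. mangoldt d) \<le> 2 * real n * ln 2"
proof -
  have "(\<Sum>d\<in>{n<..2*n}. mangoldt d)
      = (\<Sum>d\<in>{n<..2*n}. mangoldt d * (real (2 * n div d) - 2 * real (n div d)))"
  proof (intro sum.cong refl)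
    fix d assume "d \<in> {n<..2*n}"
    then have "2 * n div d = 1" "n div d = 0" by (auto intro: div_nat_eqI)
    then show "mangoldt d = mangoldt d * (real (2 * n div d) - 2 * real (n div d))" by simp
  qed
  also have "\<dots> \<le> (\<Sum>d\<in>{1..2*n}. mangoldt d * (real (2 * n div d) - 2 * real (n div d)))"
  proof (rule sum_mono2)
    fix d
    have "2 * (n div d) \<le> 2 * n div d" 
      by (cases "d = 0") (auto simp: less_eq_div_iff_mult_less_eq mult.assoc)
    then have "2 * real (n div d) \<le> real (2 * n div d)" by (metis of_nat_le_iff of_nat_mult of_nat_numeral)
    then show "0 \<le> mangoldt d * (real (2 * n div d) - 2 * real (n div d))"
      by (simp add: mangoldt_nonneg)
  qed auto
  also have "\<dots> = ln (fact (2 * n)) - 2 * ln (fact n)"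
  proof -
    have "(\<Sum>d\<in>{1..2*n}. mangoldt d * real (n div d)) = (\<Sum>d\<in>{1..n}. mangoldt d * real (n div d))"
      by (rule sum.mono_neutral_right) auto
    moreover have "mangoldt d * (real (2 * n div d) - 2 * real (n div d))
        = mangoldt d * real (2 * n div d) - 2 * (mangoldt d * real (n div d))" for d
      by (simp add: right_diff_distrib)
    ultimately show ?thesis
      by (simp only: ln_fact_eq_sum_mangoldt sum_subtractf sum_distrib_left[symmetric])
  qed
  also have "\<dots> = ln (real (2 * n choose n))"
  proof -
    have "2 * n - n = n" by simp
    then have "real (2 * n choose n) = fact (2 * n) / (fact n * fact n)"
      using binomial_fact[of n "2 * n", where ?'a = real] by simp
    then show ?thesis by (simp add: ln_div ln_mult)
  qed
  also have "\<dots> \<le> ln (2 ^ (2 * n))"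
    using binomial_le_pow2[of "2 * n" n]
    by (subst ln_le_cancel_iff) (auto simp: zero_less_binomial simp flip: of_nat_le_iff)
  finally show ?thesis by (simp add: ln_realpow)
qed

text \<open>Strong induction by halving: the range up to \<open>N\<close> is covered by the range up
  to \<open>n = (N + 1) div 2\<close> and one dyadic block.\<close>

lemma sum_mangoldt_le: "(\<Sum>d\<in>{1..N}. mangoldt d) \<le> 3 * real N"
proof (induction N rule: less_induct)
  case (less N)
  show ?case
  proof (cases "N \<le> 1")
    case True
    then have "N = 0 \<or> N = 1" by auto
    then show ?thesis by auto
  next
    case False
    define n where "n = (N + 1) div 2"
    have n: "n < N" "N \<le> 2 * n" "2 * n \<le> N + 1" using False by (auto simp: n_def)
    have "(\<Sum>d\<in>{1..N}. mangoldt d) \<le> (\<Sum>d\<in>{1..2*n}. mangoldt d :: real)"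
      using n by (intro sum_mono2) (auto simp: mangoldt_nonneg)
    also have "{1..2*n} = {1..n} \<union> {n<..2*n}" by auto
    also have "(\<Sum>d\<in>{1..n} \<union> {n<..2*n}. mangoldt d) = (\<Sum>d\<in>{1..n}. mangoldt d) + (\<Sum>d\<in>{n<..2*n}. mangoldt d :: real)"
      by (rule sum.union_disjoint) auto
    also have "\<dots> \<le> 3 * real n + 2 * real n * ln 2"
      using less.IH[OF n(1)] sum_mangoldt_dyadic[of n] by simp
    also have "\<dots> \<le> 3 * real n + 2 * real n * (3/4)"
      using ln2_le_25_over_36 by (intro add_left_mono mult_left_mono) auto
    also have "\<dots> \<le> 3 * real N"
    proof -
      have "real (2 * n) \<le> real (N + 1)" using n(3) by (simp only: of_nat_le_iff)
      then have "real n * (9/2) \<le> (real N + 1) * (9/4)" by simp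
      show ?thesis
      \<comment> \<open>The bound \<open>(real N + 1) * (9/4) \<le> 3 * real N\<close> holds only
        from 3 on. For \<open>N = 2\<close> no rounding occurs and \<open>n = 1\<close> is inserted
        directly.\<close>
      proof (cases "N = 2")
        case True
        then show ?thesis by (simp add: n_def)
      next
        case False
        then have "real N \<ge> 3" using \<open>\<not> N \<le> 1\<close> by simp
        then show ?thesis using \<open>real n * (9/2) \<le> (real N + 1) * (9/4)\<close> by argo
      qed
    qed
    finally show ?thesis .
  qed
qed

section \<open>Mertens' estimates for the trivial character and for \<open>chi4\<close>\<close>

lemma real_le_mult_div_add_1:
  assumes "d > 0"
  shows "real N \<le> real d * (real (N div d) + 1)"
proof -
  have "N \<le> d + d * (N div d)" using dividend_less_times_div[OF assms, of N] by simp
  then have "real N \<le> real (d + d * (N div d))" by (simp only: of_nat_le_iff)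
  then show ?thesis by (simp add: algebra_simps)
qed

text \<open>Dropping the integer parts in \<open>ln_fact_eq_sum_mangoldt\<close> turns
  \<open>ln (fact N)\<close> into \<open>N\<close> times the sum, at a cost of at most the Chebyshev
  sum. Only a crude form of Stirling's formula is then required.\<close>

lemma sum_mangoldt_over_n:
  assumes "N \<ge> 1"
  shows "\<bar>(\<Sum>d\<in>{1..N}. mangoldt d / d) - ln N\<bar> \<le> 3"
proof -
  let ?S = "\<Sum>d\<in>{1..N}. mangoldt d / real d"
  have upper: "ln (fact N) \<le> real N * ?S"
  proof -
    have "real (N div d) \<le> real N / real d" for d by (rule of_nat_div_le_of_nat)
    then have "mangoldt d * real (N div d) \<le> real N * (mangoldt d / real d)" for d
      using mult_left_mono[OF _ mangoldt_nonneg[of d], of "real (N div d)" "real N / real d"]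
      by (simp add: mult.commute)
    then show ?thesis unfolding ln_fact_eq_sum_mangoldt sum_distrib_left by (rule sum_mono)
  qed
  have lower: "real N * ?S - 3 * real N \<le> ln (fact N)"
  proof -
    have "real N * ?S - ln (fact N) = (\<Sum>d\<in>{1..N}. mangoldt d * (real N / real d - real (N div d)))"
      unfolding ln_fact_eq_sum_mangoldt sum_distrib_left
      by (simp flip: sum_subtractf add: algebra_simps)
    also have "\<dots> \<le> (\<Sum>d\<in>{1..N}. mangoldt d * 1)"
    proof (intro sum_mono mult_left_mono mangoldt_nonneg)
      fix d
      show "real N / real d - real (N div d) \<le> 1"
        using real_le_mult_div_add_1[of d N] by (cases "d = 0") (simp_all add: field_simps)
    qed
    also have "\<dots> \<le> 3 * real N" using sum_mangoldt_le by simp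
    finally show ?thesis by simp
  qed
  have fact_le: "ln (fact N) \<le> real N * ln N"
  proof -
    have "fact N \<le> real N ^ N" using fact_le_power[of N, where ?'a = real] by simp
    then have "ln (fact N) \<le> ln (real N ^ N)" using assms by (subst ln_le_cancel_iff) auto
    then show ?thesis using assms by (simp add: ln_realpow)
  qed
  have fact_ge: "real N * ln N - real N \<le> ln (fact N)"
  proof -
    \<comment> \<open>One term of the exponential series is at most the whole series.\<close>
    have "real N ^ N /\<^sub>R fact N \<le> exp (real N)"
      unfolding exp_def
      using sum_le_suminf[OF summable_exp_generic[of "real N"], of "{N}"] by simp
    then have "real N ^ N \<le> exp (real N) * fact N" by (simp add: field_simps)
    then have "ln (real N ^ N) \<le> ln (exp (real N) * fact N)" using assms by (subst ln_le_cancel_iff) auto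
    then show ?thesis using assms by (simp add: ln_realpow ln_mult)
  qed
  have "real N * (?S - ln N) \<le> real N * 3"
    using lower fact_le by (simp add: algebra_simps)
  moreover have "real N * (- 3) \<le> real N * (?S - ln N)"
    using upper fact_ge assms by (simp add: algebra_simps)
  ultimately have "?S - ln N \<le> 3" "-3 \<le> ?S - ln N"
    using assms by (simp_all only: mult_le_cancel_left_pos of_nat_0_less_iff)
  then show ?thesis by linarith
qed

text \<open>Mertens' method: \<open>chi4 n * ln n / n\<close> is a divisor convolution, so its sum
  contains inner sums of \<open>chi4 m / m\<close>. Replacing each of them by \<open>pi / 4\<close>
  costs at most \<open>2 / N * mangoldt d\<close>, hence 6 in total by Chebyshev. Since the
  convolved sum is bounded by \<open>ln 3\<close>, division by the nonzero \<open>pi / 4\<close>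
  finishes the argument.\<close>

lemma sum_chi4_mangoldt_bounded:
  "\<exists>B. \<forall>N. \<bar>\<Sum>d\<in>{1..N}. chi4 d * mangoldt d / d\<bar> \<le> B"
proof -
  have "\<bar>\<Sum>d\<in>{1..N}. chi4 d * mangoldt d / d\<bar> \<le> 4 / pi * (6 + ln 3)" for N
  proof (cases "N = 0")
    case False
    let ?S = "\<Sum>d\<in>{1..N}. chi4 d * mangoldt d / d"
    have "(\<Sum>n\<in>{1..N}. chi4 n * ln n / n) = (\<Sum>n\<in>{1..N}. \<Sum>d | d dvd n. chi4 d * mangoldt d / d * (chi4 (n div d) / (n div d)))"
    proof (intro sum.cong refl)
      fix n assume n: "n \<in> {1..N}"
      have "chi4 n * ln n / n = (\<Sum>d | d dvd n. chi4 n / n * mangoldt d)"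
        using n mangoldt_sum[of n, where ?'a = real] unfolding sum_distrib_left[symmetric] by simp
      also have "\<dots> = (\<Sum>d | d dvd n. chi4 d * mangoldt d / d * (chi4 (n div d) / (n div d)))"
        using n by (intro sum.cong refl) (auto elim!: dvdE simp: chi4_mult)
      finally show "chi4 n * ln n / n = (\<Sum>d | d dvd n. chi4 d * mangoldt d / d * (chi4 (n div d) / (n div d)))" .
    qed
    also have "\<dots> = (\<Sum>d\<in>{1..N}. \<Sum>m\<in>{1..N div d}. chi4 d * mangoldt d / d * (chi4 m / m))"
      by (rule sum_divisors_swap)
    also have "\<dots> = (\<Sum>d\<in>{1..N}. chi4 d * mangoldt d / d * (\<Sum>m\<in>{1..N div d}. chi4 m / m))"
      by (simp add: sum_distrib_left)
    finally have eq: "(\<Sum>n\<in>{1..N}. chi4 n * ln n / n) = \<dots>" .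
    have "\<bar>pi / 4 * ?S - (\<Sum>n\<in>{1..N}. chi4 n * ln n / n)\<bar>
        = \<bar>\<Sum>d\<in>{1..N}. chi4 d * mangoldt d / d * (pi / 4 - (\<Sum>m\<in>{1..N div d}. chi4 m / m))\<bar>"
      unfolding eq sum_distrib_left right_diff_distrib sum_subtractf by (simp only: mult.commute)
    also have "\<dots> \<le> (\<Sum>d\<in>{1..N}. 2 / N * mangoldt d)"
    proof (rule order.trans[OF sum_abs sum_mono])
      fix d assume d: "d \<in> {1..N}"
      have "\<bar>chi4 d * mangoldt d / d * (pi / 4 - (\<Sum>m\<in>{1..N div d}. chi4 m / m))\<bar>
          = \<bar>chi4 d\<bar> * (mangoldt d / d * \<bar>pi / 4 - (\<Sum>m\<in>{1..N div d}. chi4 m / m)\<bar>)"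
        by (simp add: abs_mult)
      also have "\<dots> \<le> 1 * (mangoldt d / d * (2 / (real (N div d) + 1)))"
        using abs_chi4_le[of d] chi4_over_n_tail[of "N div d"] mangoldt_nonneg[of d]
        by (intro mult_mono mult_left_mono) (auto simp: add.commute)
      also have "\<dots> = 2 / (real d * (real (N div d) + 1)) * mangoldt d" by simp
      also have "\<dots> \<le> 2 / N * mangoldt d"
      proof (intro mult_right_mono divide_left_mono mangoldt_nonneg)
        show "real N \<le> real d * (real (N div d) + 1)" using d by (intro real_le_mult_div_add_1) auto
      qed (use False d in auto)
      finally show "\<bar>chi4 d * mangoldt d / d * (pi / 4 - (\<Sum>m\<in>{1..N div d}. chi4 m / m))\<bar> \<le> 2 / N * mangoldt d" .
    qed
    also have "\<dots> = 2 / N * (\<Sum>d\<in>{1..N}. mangoldt d)" by (simp add: sum_distrib_left)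
    also have "\<dots> \<le> 2 / N * (3 * real N)"
      by (intro mult_left_mono sum_mangoldt_le) auto
    also have "\<dots> = 6" using False by simp
    finally have "\<bar>pi / 4 * ?S\<bar> \<le> 6 + ln 3" using abs_sum_chi4_ln_le[of N] by linarith
    then have "pi / 4 * \<bar>?S\<bar> \<le> 6 + ln 3" by (simp add: abs_mult)
    then show ?thesis by (simp add: field_simps)
  qed (simp add: add_nonneg_nonneg)
  then show ?thesis by blast
qed

subsection \<open>Prime sums with error O(1)\<close>

lemma sum_power_from_2_le:
  fixes x :: real
  assumes "0 \<le> x" "x \<le> 1/2"
  shows "(\<Sum>k\<in>{2..N}. x ^ k) \<le> 2 * x\<^sup>2"
proof -
  \<comment> \<open>With the upper index \<open>N + 1\<close> the closed form already holds at
    \<open>N = 0\<close>, where the range is empty.\<close>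
  have "(1 - x) * (\<Sum>k\<in>{2..N + 1}. x ^ k) = x\<^sup>2 - x ^ (N + 2)" for N
  proof (induction N)
    case (Suc N)
    have "{2..Suc N + 1} = insert (N + 2) {2..N + 1}" by auto
    then have "(\<Sum>k\<in>{2..Suc N + 1}. x ^ k) = x ^ (N + 2) + (\<Sum>k\<in>{2..N + 1}. x ^ k)" by simp
    then have "(1 - x) * (\<Sum>k\<in>{2..Suc N + 1}. x ^ k) = (1 - x) * x ^ (N + 2) + (x\<^sup>2 - x ^ (N + 2))"
      by (simp only: distrib_left Suc.IH)
    also have "\<dots> = x\<^sup>2 - x ^ (Suc N + 2)" by (simp add: algebra_simps)
    finally show ?case .
  qed (simp add: power2_eq_square)
  then have "(1 - x) * (\<Sum>k\<in>{2..N + 1}. x ^ k) \<le> x\<^sup>2" using assms by simp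
  moreover have "(1/2) * (\<Sum>k\<in>{2..N + 1}. x ^ k) \<le> (1 - x) * (\<Sum>k\<in>{2..N + 1}. x ^ k)"
    using assms by (intro mult_right_mono sum_nonneg) auto
  moreover have "(\<Sum>k\<in>{2..N}. x ^ k) \<le> (\<Sum>k\<in>{2..N + 1}. x ^ k)"
    using assms by (intro sum_mono2) auto
  ultimately show ?thesis by linarith
qed

text \<open>Only the powers \<open>p ^ k\<close> with \<open>k \<ge> 2\<close> contribute. For fixed
  \<open>p\<close> the geometric sum gives at most \<open>2 * ln p / p^2\<close>, and
  \<open>ln p \<le> 2 * sqrt p\<close> leaves a multiple of \<open>p powr (-3/2)\<close>, which is
  summable even over all integers.\<close>

lemma sum_mangoldt_nonprime_bounded:
  "\<exists>B. \<forall>N. (\<Sum>n\<in>{n\<in>{1..N}. \<not> prime n}. mangoldt n / n) \<le> B"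
proof -
  have "(\<Sum>n\<in>{n\<in>{1..N}. \<not> prime n}. mangoldt n / n) \<le> (\<Sum>n. 4 * real n powr (-3/2))" for N
  proof -
    define P where "P = {p\<in>{1..N}. prime p}"
    have fP: "finite P" by (simp add: P_def)
    have "(\<Sum>n\<in>{n\<in>{1..N}. \<not> prime n}. mangoldt n / n)
        \<le> (\<Sum>n\<in>(\<lambda>(p, k). p ^ k) ` (P \<times> {2..N}). mangoldt n / n :: real)"
    proof -
      have "(\<Sum>n\<in>{n\<in>{1..N}. \<not> prime n}. mangoldt n / n)
          = (\<Sum>n\<in>{n\<in>{1..N}. \<not> prime n \<and> primepow n}. mangoldt n / n :: real)"
        by (rule sum.mono_neutral_right) (auto simp: mangoldt_def)
      also have "\<dots> \<le> (\<Sum>n\<in>(\<lambda>(p, k). p ^ k) ` (P \<times> {2..N}). mangoldt n / n)"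
      proof (rule sum_mono2)
        show "{n\<in>{1..N}. \<not> prime n \<and> primepow n} \<subseteq> (\<lambda>(p, k). p ^ k) ` (P \<times> {2..N})"
        proof
          fix n assume "n \<in> {n\<in>{1..N}. \<not> prime n \<and> primepow n}"
          then obtain p k where n: "n = p ^ k" "prime p" "k > 0" "\<not> prime n" "n \<le> N"
            by (auto simp: primepow_def)
          have "k \<noteq> 1" using n by auto
          moreover have "p \<le> p ^ k" using n prime_gt_0_nat[of p] by (intro self_le_power) auto
          moreover have "k < p ^ k"
            using n prime_ge_2_nat[of p] by (intro less_le_trans[OF less_exp] power_mono) auto
          moreover have "p > 0" using n by (simp add: prime_gt_0_nat)
          ultimately have "(p, k) \<in> P \<times> {2..N}" using n unfolding P_def by auto
          then show "n \<in> (\<lambda>(p, k). p ^ k) ` (P \<times> {2..N})" using n by force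
        qed
      qed (auto simp: fP mangoldt_nonneg)
      finally show ?thesis .
    qed
    also have "\<dots> \<le> (\<Sum>x\<in>P \<times> {2..N}. ((\<lambda>n. mangoldt n / n) \<circ> (\<lambda>(p, k). p ^ k)) x)"
      by (rule sum_image_le) (auto simp: fP mangoldt_nonneg)
    also have "\<dots> = (\<Sum>p\<in>P. \<Sum>k\<in>{2..N}. mangoldt (p ^ k) / (p ^ k))"
      by (simp add: sum.cartesian_product case_prod_unfold)
    also have "\<dots> \<le> (\<Sum>p\<in>P. 4 * real p powr (-3/2))"
    proof (rule sum_mono)
      fix p assume "p \<in> P"
      then have p: "prime p" by (simp add: P_def)
      then have p2: "real p \<ge> 2" using prime_ge_2_nat[of p] by simp
      have "(\<Sum>k\<in>{2..N}. mangoldt (p ^ k) / (p ^ k)) = ln p * (\<Sum>k\<in>{2..N}. (1 / real p) ^ k)"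
        using p by (simp add: sum_distrib_left power_one_over mangoldt_primepow divide_inverse power_inverse)
      also have "\<dots> \<le> ln p * (2 * (1 / real p)\<^sup>2)"
        using p2 by (intro mult_left_mono sum_power_from_2_le) auto
      also have "ln p \<le> 2 * sqrt p"
      proof -
        have "ln p = 2 * ln (sqrt p)" using p2 by (simp add: ln_sqrt)
        then show ?thesis using ln_le_minus_one[of "sqrt p"] p2 by simp
      qed
      then have "ln p * (2 * (1 / real p)\<^sup>2) \<le> 2 * sqrt p * (2 * (1 / real p)\<^sup>2)"
        by (intro mult_right_mono) auto
      also have "\<dots> = 4 * real p powr (-3/2)"
      proof -
        have "sqrt p * (1 / real p)\<^sup>2 = real p powr (1/2) * real p powr (-2)"
        proof -
          have "real p powr (-2) = (1 / real p)\<^sup>2" using p2 by (simp add: powr_neg_numeral power_one_over)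
          moreover have "real p powr (1/2) = sqrt p" using p2 by (simp add: powr_half_sqrt)
          ultimately show ?thesis by (simp only:)
        qed
        also have "\<dots> = real p powr (1/2 + (-2))" by (rule powr_add[symmetric])
        also have "1/2 + (-2) = (-3/2 :: real)" by simp
        finally have "sqrt p * (1 / real p)\<^sup>2 = real p powr (-3/2)" .
        then show ?thesis by (simp only: mult_ac)
      qed
      finally show "(\<Sum>k\<in>{2..N}. mangoldt (p ^ k) / (p ^ k)) \<le> 4 * real p powr (-3/2)" by simp
    qed
    also have "\<dots> \<le> (\<Sum>n. 4 * real n powr (-3/2))"
      using fP by (intro sum_le_suminf summable_mult) (auto simp: summable_real_powr_iff)
    finally show ?thesis .
  qed
  then show ?thesis by blast
qed

text \<open>This is the indicator \<open>q\<close> of the overview, real valued so that sums over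
  these primes become weighted sums over all integers.\<close>

definition prime3 :: "nat \<Rightarrow> real" where
  "prime3 n = (if prime n \<and> n mod 4 = 3 then 1 else 0)"

text \<open>On odd primes the factor \<open>1 - chi4\<close> is 2 in the class 3 mod 4 and 0 in the
  class 1 mod 4, so the difference of the two Mertens sums isolates the wanted primes.\<close>

lemma sum_prime3_ln:
  "\<exists>B. \<forall>N\<ge>1. \<bar>(\<Sum>n\<in>{1..N}. 2 * prime3 n * ln n / n) - ln N\<bar> \<le> B"
proof -
  obtain B1 where B1: "\<And>N. (\<Sum>n\<in>{n\<in>{1..N}. \<not> prime n}. mangoldt n / n) \<le> B1"
    using sum_mangoldt_nonprime_bounded by auto
  obtain B2 where B2: "\<And>N. \<bar>\<Sum>d\<in>{1..N}. chi4 d * mangoldt d / d\<bar> \<le> B2"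
    using sum_chi4_mangoldt_bounded by auto
  \<comment> \<open>The excess of the difference over the wanted sum; it lives on the prime 2 and on
    the prime powers that are not prime.\<close>
  define u where "u n = (1 - chi4 n) * mangoldt n / n - 2 * prime3 n * ln n / n" for n :: nat
  have u: "0 \<le> u n \<and> u n \<le> (if n = 2 then 1 else 0) + 2 * (if prime n then 0 else mangoldt n / n)" for n
  proof (cases "prime n")
    case True
    consider "n = 2" | "n mod 4 = 1" | "n mod 4 = 3"
    proof -
      assume *: "n = 2 \<Longrightarrow> thesis" "n mod 4 = 1 \<Longrightarrow> thesis" "n mod 4 = 3 \<Longrightarrow> thesis"
      show thesis
      proof (cases "n = 2")
        case False
        then have "odd n" using True prime_ge_2_nat[OF True] prime_odd_nat[of n] by auto
        then have "n mod 4 = 1 \<or> n mod 4 = 3" by presburger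
        then show thesis using * by blast
      qed (use * in auto)
    qed
    then show ?thesis
    proof cases
      case 1
      then show ?thesis using ln2_le_25_over_36 by (simp add: u_def chi4_def prime3_def)
    qed (use True in \<open>auto simp: u_def chi4_def prime3_def\<close>)
  next
    case False
    have "0 \<le> (1 - chi4 n) * (mangoldt n / n)"
      using abs_chi4_le[of n] by (intro mult_nonneg_nonneg) (auto simp: mangoldt_nonneg)
    moreover have "(1 - chi4 n) * (mangoldt n / n) \<le> 2 * (mangoldt n / n)"
      using abs_chi4_le[of n] by (intro mult_right_mono) (auto simp: mangoldt_nonneg)
    ultimately show ?thesis using False by (auto simp: u_def prime3_def)
  qed
  have "\<bar>(\<Sum>n\<in>{1..N}. 2 * prime3 n * ln n / n) - ln N\<bar> \<le> 3 + B2 + (1 + 2 * B1)" if N: "N \<ge> 1" for N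
  proof -
    have "(\<Sum>n\<in>{1..N}. 2 * prime3 n * ln n / n) = (\<Sum>n\<in>{1..N}. mangoldt n / n)
        - (\<Sum>n\<in>{1..N}. chi4 n * mangoldt n / n) - (\<Sum>n\<in>{1..N}. u n)"
      unfolding sum_subtractf[symmetric]
      by (intro sum.cong refl) (simp add: u_def left_diff_distrib diff_divide_distrib)
    moreover have "0 \<le> (\<Sum>n\<in>{1..N}. u n)" using u by (intro sum_nonneg) auto
    moreover have "(\<Sum>n\<in>{1..N}. u n) \<le> 1 + 2 * B1"
    proof -
      have "(\<Sum>n\<in>{1..N}. u n) \<le> (\<Sum>n\<in>{1..N}. (if n = 2 then 1 else 0) + 2 * (if prime n then 0 else mangoldt n / n))"
        using u by (intro sum_mono) auto
      also have "\<dots> = (\<Sum>n\<in>{1..N}. if n = 2 then 1 else 0) + 2 * (\<Sum>n\<in>{1..N}. if prime n then 0 else mangoldt n / n)"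
        by (simp only: sum.distrib sum_distrib_left)
      also have "(\<Sum>n\<in>{1..N}. if prime n then 0 else mangoldt n / n) = (\<Sum>n\<in>{n\<in>{1..N}. \<not> prime n}. mangoldt n / n :: real)"
        by (rule sum.mono_neutral_cong_right) auto
      also have "(\<Sum>n\<in>{1..N}. if n = 2 then 1 else 0) \<le> (1 :: real)" by simp
      finally show ?thesis using B1[of N] by simp
    qed
    ultimately show ?thesis using sum_mangoldt_over_n[OF N] B2[of N] by linarith
  qed
  then show ?thesis by blast
qed

text \<open>Subtracting the increments of ln from \<open>c\<close> leaves terms \<open>c'\<close>
  with bounded partial sums, to which Dirichlet's test with weights 1 / ln n applies. The subtracted
  increments, divided by ln n, follow the increments of ln (ln n) up to the summable error
  \<open>e\<close>.\<close>

lemma convergent_sum_over_ln: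
  fixes c :: "nat \<Rightarrow> real"
  assumes bound: "\<And>N. N \<ge> 1 \<Longrightarrow> \<bar>(\<Sum>n\<in>{1..N}. c n) - ln N\<bar> \<le> B"
  shows "convergent (\<lambda>N. (\<Sum>n\<in>{2..N}. c n / ln n) - ln (ln N))"
proof -
  define c' where "c' k = c (k + 2) - (ln (real (k + 2)) - ln (real (k + 1)))" for k
  define e where "e k = (ln (real (k + 3)) - ln (real (k + 2))) / ln (real (k + 3))
      - (ln (ln (real (k + 3))) - ln (ln (real (k + 2))))" for k
  have sum_c': "(\<Sum>k<j. c' k) = (\<Sum>n\<in>{1..j + 1}. c n) - ln (real (j + 1)) - c 1" for j
    by (induction j) (simp_all add: c'_def algebra_simps)
  have "\<bar>c 1\<bar> \<le> B" using bound[of 1] by simp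
  then have c'_bound: "\<bar>\<Sum>k<j. c' k\<bar> \<le> 2 * B" for j
    using bound[of "j + 1"] unfolding sum_c' by linarith
  have s1: "summable (\<lambda>k. c' k * (1 / ln (real (k + 2))))"
  proof (rule summable_mult_antimono(1)[OF c'_bound])
    show "(\<lambda>k. 1 / ln (real (k + 2))) \<longlonglongrightarrow> 0" by real_asymp
    show "1 / ln (real (Suc k + 2)) \<le> 1 / ln (real (k + 2))" for k
      by (intro divide_left_mono mult_pos_pos) auto
  qed auto
  have s2: "summable e"
  proof (rule summable_comparison_test')
    \<comment> \<open>The majorant for \<open>e\<close> is a telescoping series.\<close>
    have "(\<lambda>k. 1 / ln (real (k + 2))) \<longlonglongrightarrow> 0" by real_asymp
    then have "summable (\<lambda>k. 1 / ln (real (k + 2)) - 1 / ln (real (Suc k + 2)))"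
      by (rule telescope_summable')
    then show "summable (\<lambda>k. 1 / ln (real (k + 2)) - 1 / ln (real (k + 3)))"
      by (simp add: numeral_3_eq_3)
    fix k :: nat
    define x y where "x = ln (real (k + 2))" and "y = ln (real (k + 3))"
    have x: "x > 0" and xy: "x < y" by (auto simp: x_def y_def)
    have "real (k + 3) / real (k + 2) \<le> exp 1"
      by (rule order.trans[OF _ order.trans[OF _ exp_ge_add_one_self]]) (auto simp: field_simps)
    then have "ln (real (k + 3) / real (k + 2)) \<le> ln (exp 1)"
      by (subst ln_le_cancel_iff) auto
    then have "ln (real (k + 3) / real (k + 2)) \<le> 1" unfolding ln_exp .
    then have d: "y - x \<le> 1" by (simp add: x_def y_def ln_div)
    have "ln (y / x) \<le> y / x - 1" using x xy by (intro ln_le_minus_one) auto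
    then have 1: "ln y - ln x \<le> (y - x) / x" using x xy by (simp add: ln_div field_simps)
    have "ln (x / y) \<le> x / y - 1" using x xy by (intro ln_le_minus_one) auto
    then have 2: "(y - x) / y \<le> ln y - ln x" using x xy by (simp add: ln_div field_simps)
    have "(y - x) / x - (y - x) / y = (y - x) * (1 / x - 1 / y)" by (simp add: right_diff_distrib)
    also have "\<dots> \<le> 1 * (1 / x - 1 / y)"
      using d x xy by (intro mult_right_mono) (auto simp: field_simps)
    finally have 3: "(y - x) / x - (y - x) / y \<le> 1 / x - 1 / y" by (simp only: mult_1)
    \<comment> \<open>Here \<open>l\<close> is the increment \<open>ln y - ln x\<close>, enclosed
      between \<open>p = (y - x) / y\<close> and \<open>q = (y - x) / x\<close>; its distance from
      \<open>p\<close> is therefore at most \<open>q - p\<close>.\<close>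
    have "\<bar>p - l\<bar> \<le> u - v" if "l \<le> q" "p \<le> l" "q - p \<le> u - v" for p l q u v :: real
      using that by linarith
    from this[OF 1 2 3] show "norm (e k) \<le> 1 / ln (real (k + 2)) - 1 / ln (real (k + 3))"
      unfolding e_def x_def[symmetric] y_def[symmetric] real_norm_def .
  qed
  \<comment> \<open>The constant 1 is the increment removed at 2,
    \<open>(ln 2 - ln 1) / ln 2\<close>; \<open>ln (ln 2)\<close> is where the telescoping
    starts.\<close>
  have eq: "(\<Sum>n\<in>{2..j + 2}. c n / ln n) - ln (ln (real (j + 2)))
      = (\<Sum>k<Suc j. c' k * (1 / ln (real (k + 2)))) + (\<Sum>k<j. e k) + (1 - ln (ln 2))" for j
  proof (induction j)
    case 0
    have "{2..2::nat} = {2}" by auto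
    then show ?case by (simp add: c'_def field_simps)
  next
    case (Suc j)
    have j3: "Suc j + 2 = j + 3" by simp
    have "{2..j + 3} = insert (j + 3) {2..j + 2}" by auto
    then have "(\<Sum>n\<in>{2..j + 3}. c n / ln n) = (\<Sum>n\<in>{2..j + 2}. c n / ln n) + c (j + 3) / ln (real (j + 3))"
      by simp
    moreover have "c' (Suc j) * (1 / ln (real (j + 3)))
        = c (j + 3) / ln (real (j + 3)) - (ln (real (j + 3)) - ln (real (j + 2))) / ln (real (j + 3))"
      by (simp add: c'_def numeral_3_eq_3 diff_divide_distrib)
    moreover have "e j = (ln (real (j + 3)) - ln (real (j + 2))) / ln (real (j + 3))
        - (ln (ln (real (j + 3))) - ln (ln (real (j + 2))))" by (simp only: e_def)
    ultimately show ?case using Suc.IH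
      unfolding j3 sum.lessThan_Suc[of _ j] sum.lessThan_Suc[of _ "Suc j"] by linarith
  qed
  have "(\<lambda>j. (\<Sum>k<Suc j. c' k * (1 / ln (real (k + 2)))) + (\<Sum>k<j. e k) + (1 - ln (ln 2)))
      \<longlonglongrightarrow> (\<Sum>k. c' k * (1 / ln (real (k + 2)))) + (\<Sum>k. e k) + (1 - ln (ln 2))"
    by (intro tendsto_add tendsto_const summable_LIMSEQ s2 LIMSEQ_Suc[OF summable_LIMSEQ] s1)
  then have "convergent (\<lambda>j. (\<Sum>n\<in>{2..j + 2}. c n / ln n) - ln (ln (real (j + 2))))"
    unfolding eq convergent_def by blast
  then show ?thesis
    by (subst (asm) convergent_ignore_initial_segment[of "\<lambda>N. (\<Sum>n\<in>{2..N}. c n / ln n) - ln (ln N)"])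
qed

subsection \<open>An Abelian theorem for sums asymptotic to ln (ln N)\<close>

lemma sums_powser_ln:
  fixes r :: real
  assumes "0 < r" "r < 1"
  shows "(\<lambda>k. 1 / Suc k * r ^ Suc k) sums (- ln (1 - r))"
proof -
  have sm: "summable (\<lambda>k. 1 / Suc k * r ^ Suc k)"
  proof (rule summable_comparison_test')
    show "summable (\<lambda>k. r ^ k)" using assms by simp
    fix k :: nat
    have "r ^ Suc k \<le> r ^ k" using assms by (intro power_decreasing) auto
    moreover have "1 / real (Suc k) * r ^ Suc k \<le> 1 * r ^ Suc k"
      using assms by (intro mult_right_mono) auto
    ultimately have "1 / real (Suc k) * r ^ Suc k \<le> r ^ k" by linarith
    then show "norm (1 / real (Suc k) * r ^ Suc k) \<le> r ^ k"
      using assms by (simp only: real_norm_def abs_mult) simp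
  qed
  have "ln (1 - r) = (\<Sum>n. (-1) ^ n * (1 / real (n + 1)) * (1 - r - 1) ^ Suc n)"
    using assms by (intro ln_series) auto
  moreover have "(-1) ^ n * (1 / real (n + 1)) * (1 - r - 1) ^ Suc n = - (1 / Suc n * r ^ Suc n)" for n
  proof -
    have "(-1) ^ n * (- r) ^ Suc n = - (r ^ Suc n)"
      by (subst power_minus) (simp add: mult.left_commute flip: power_mult_distrib)
    then show ?thesis by (simp add: field_simps)
  qed
  ultimately have "ln (1 - r) = - (\<Sum>k. 1 / Suc k * r ^ Suc k)"
    by (simp only: suminf_minus[OF sm])
  with sm show ?thesis by (simp only: sums_iff minus_minus)
qed

text \<open>On the block number \<open>k\<close> the factor \<open>real n powr - \<delta>\<close>
  lies between \<open>r ^ Suc k\<close> and \<open>r ^ k\<close> with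
  \<open>r = 2 powr - \<delta>\<close>, so the Dirichlet series is squeezed between a power series
  in \<open>r\<close> and its quotient by \<open>r\<close>. The block sums behave like
  \<open>1 / Suc k\<close>, whose power series is \<open>- ln (1 - r)\<close>, and the comparison
  with harmonic numbers brings in \<open>euler_mascheroni\<close>.\<close>

lemma abel_ln_ln:
  fixes a :: "nat \<Rightarrow> real"
  assumes nonneg: "\<And>n. a n \<ge> 0" and zero: "a 0 = 0" "a 1 = 0"
    and lim: "(\<lambda>N. (\<Sum>n\<in>{2..N}. a n) - ln (ln N)) \<longlonglongrightarrow> C"
    and sm: "\<And>\<delta>. \<delta> > 0 \<Longrightarrow> summable (\<lambda>n. a n * real n powr - \<delta>)"
  shows "((\<lambda>\<delta>. (\<Sum>n. a n * real n powr - \<delta>) + ln \<delta>) \<longlongrightarrow> C - euler_mascheroni) (at_right 0)"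
proof -
  define A where "A k = (\<Sum>n\<in>{2^k<..2^Suc k}. a n)" for k :: nat
  define b where "b k = A k - 1 / Suc k" for k :: nat
  \<comment> \<open>The sum of \<open>b\<close>: at \<open>2 ^ K\<close> the double logarithm is
    \<open>ln K + ln (ln 2)\<close>, and \<open>harm K - ln K\<close> tends to
    \<open>euler_mascheroni\<close>.\<close>
  define Y where "Y = C + ln (ln 2) - euler_mascheroni"
  define D where "D \<delta> = (\<Sum>n. a n * real n powr - \<delta>)" for \<delta>
  define r where "r \<delta> = 2 powr - \<delta>" for \<delta> :: real
  define X where "X \<delta> = (\<Sum>k. b k * r \<delta> ^ Suc k)" for \<delta>
  have blocks: "(\<Sum>k<K. \<Sum>n\<in>{2^k<..2^Suc k}. f n) = (\<Sum>n\<in>{2..2^K}. f n)"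
    for f :: "nat \<Rightarrow> real" and K
  proof (induction K)
    case (Suc K)
    have "(1::nat) \<le> 2 ^ K" by simp
    then have "{2..2 ^ Suc K} = {2..2 ^ K} \<union> {2 ^ K<..(2::nat) ^ Suc K}" by auto
    then have "(\<Sum>n\<in>{2..2^Suc K}. f n) = (\<Sum>n\<in>{2..2^K}. f n) + (\<Sum>n\<in>{2^K<..2^Suc K}. f n)"
      by (simp only: ) (rule sum.union_disjoint, auto)
    with Suc show ?case by simp
  qed simp
  have b_sums: "b sums Y"
    unfolding sums_def
  proof (rule Lim_transform_eventually)
    have "filterlim (\<lambda>K. 2 ^ K :: nat) at_top sequentially"
      by (rule filterlim_subseq) (auto simp: strict_mono_def)
    then have "(\<lambda>K. (\<Sum>n\<in>{2..2^K}. a n) - ln (ln (real (2 ^ K)))) \<longlonglongrightarrow> C"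
      by (rule filterlim_compose[OF lim])
    then show "(\<lambda>K. (\<Sum>n\<in>{2..2^K}. a n) - ln (ln (real (2 ^ K))) + ln (ln 2) - (harm K - ln K)) \<longlonglongrightarrow> Y"
      unfolding Y_def by (intro tendsto_intros euler_mascheroni_LIMSEQ)
    show "\<forall>\<^sub>F K in sequentially. (\<Sum>n\<in>{2..2^K}. a n) - ln (ln (real (2 ^ K))) + ln (ln 2) - (harm K - ln K) = (\<Sum>k<K. b k)"
      using eventually_gt_at_top[of 0]
    proof eventually_elim
      case (elim K)
      have "ln (real (2 ^ K)) = K * ln 2" by (simp add: ln_realpow)
      then have "ln (ln (real (2 ^ K))) = ln K + ln (ln 2)" using elim by (simp add: ln_mult)
      moreover have "(\<Sum>k<K. b k) = (\<Sum>n\<in>{2..2^K}. a n) - harm K"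
        unfolding blocks[symmetric] b_def A_def harm_altdef by (simp add: sum_subtractf inverse_eq_divide)
      ultimately show ?case by simp
    qed
  qed
  have r: "0 < r \<delta>" "r \<delta> < 1" if "\<delta> > 0" for \<delta>
    using that by (auto simp: r_def powr_less_one)
  have b_summable: "summable (\<lambda>k. b k * r \<delta> ^ Suc k)" if "\<delta> > 0" for \<delta>
  proof -
    have "Bseq b" using b_sums by (intro summable_imp_Bseq) (auto simp: sums_iff)
    then obtain M where M: "\<And>k. norm (b k) \<le> M" by (auto simp: Bseq_def)
    show ?thesis
    proof (rule summable_comparison_test')
      show "summable (\<lambda>k. M * (r \<delta> * r \<delta> ^ k))" using r[OF that] by (intro summable_mult) simp
      show "norm (b k * r \<delta> ^ Suc k) \<le> M * (r \<delta> * r \<delta> ^ k)" for k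
        using M[of k] r[OF that] by (simp add: abs_mult mult_right_mono)
    qed
  qed
  have "(X \<longlongrightarrow> suminf b) (at_right 0)"
    unfolding X_def
  proof (rule abel_limit)
    show "summable b" using b_sums by (auto simp: sums_iff)
    have "\<forall>\<^sub>F \<delta> in at_right 0. \<delta> > (0::real)" by (auto simp: eventually_at_right_less)
    then show "\<forall>\<^sub>F \<delta> in at_right 0. antimono (\<lambda>k. r \<delta> ^ Suc k) \<and>
        (\<forall>k. 0 \<le> r \<delta> ^ Suc k \<and> r \<delta> ^ Suc k \<le> 1) \<and> summable (\<lambda>k. b k * r \<delta> ^ Suc k)"
    proof eventually_elim
      case (elim \<delta>)
      then show ?case using r[OF elim] b_summable[OF elim]
        by (auto simp: antimono_def simp del: power_Suc intro!: power_decreasing power_le_one)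
    qed
    have "(r \<longlongrightarrow> 1) (at_right 0)" unfolding r_def by real_asymp
    then have "((\<lambda>\<delta>. r \<delta> ^ Suc k) \<longlongrightarrow> 1 ^ Suc k) (at_right 0)" for k by (intro tendsto_power)
    then show "((\<lambda>\<delta>. r \<delta> ^ Suc k) \<longlongrightarrow> 1) (at_right 0)" for k by simp
  qed
  then have X: "(X \<longlongrightarrow> Y) (at_right 0)" using b_sums by (simp add: sums_iff)
  have bounds: "X \<delta> - ln (1 - r \<delta>) \<le> D \<delta>" "D \<delta> \<le> (X \<delta> - ln (1 - r \<delta>)) / r \<delta>" if "\<delta> > 0" for \<delta>
  proof -
    have "(\<lambda>k. b k * r \<delta> ^ Suc k + 1 / Suc k * r \<delta> ^ Suc k) sums (X \<delta> + - ln (1 - r \<delta>))"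
      unfolding X_def using b_summable[OF that] r[OF that]
      by (intro sums_add sums_powser_ln) (auto simp: summable_sums_iff[symmetric])
    moreover have "b k * r \<delta> ^ Suc k + 1 / Suc k * r \<delta> ^ Suc k = A k * r \<delta> ^ Suc k" for k
      unfolding b_def by (simp only: distrib_right[symmetric]) simp
    ultimately have A: "(\<lambda>k. A k * r \<delta> ^ Suc k) sums (X \<delta> - ln (1 - r \<delta>))" by simp
    have pow: "r \<delta> ^ k = real (2 ^ k) powr - \<delta>" for k
      by (simp add: r_def powr_powr powr_realpow[symmetric] mult.commute)
    have block: "A k * r \<delta> ^ Suc k \<le> (\<Sum>n\<in>{2^k<..2^Suc k}. a n * real n powr - \<delta>)"
      "r \<delta> * (\<Sum>n\<in>{2^k<..2^Suc k}. a n * real n powr - \<delta>) \<le> A k * r \<delta> ^ Suc k" for k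
    proof -
      show "A k * r \<delta> ^ Suc k \<le> (\<Sum>n\<in>{2^k<..2^Suc k}. a n * real n powr - \<delta>)"
        unfolding A_def sum_distrib_right pow
      proof (intro sum_mono mult_left_mono nonneg)
        fix n :: nat assume n: "n \<in> {2^k<..2^Suc k}"
        then have "real n \<le> real (2 ^ Suc k)" by (simp only: of_nat_le_iff) simp
        then show "real (2 ^ Suc k) powr - \<delta> \<le> real n powr - \<delta>"
          using n that by (intro powr_mono2') auto
      qed
      have "(\<Sum>n\<in>{2^k<..2^Suc k}. a n * real n powr - \<delta>) \<le> A k * r \<delta> ^ k"
        unfolding A_def sum_distrib_right pow
      proof (intro sum_mono mult_left_mono nonneg)
        fix n :: nat assume n: "n \<in> {2^k<..2^Suc k}"
        then have "real (2 ^ k) \<le> real n" by (simp only: of_nat_le_iff) simp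
        then show "real n powr - \<delta> \<le> real (2 ^ k) powr - \<delta>"
          using that by (intro powr_mono2') auto
      qed
      then have "r \<delta> * (\<Sum>n\<in>{2^k<..2^Suc k}. a n * real n powr - \<delta>) \<le> r \<delta> * (A k * r \<delta> ^ k)"
        using r[OF that] by (intro mult_left_mono) auto
      then show "r \<delta> * (\<Sum>n\<in>{2^k<..2^Suc k}. a n * real n powr - \<delta>) \<le> A k * r \<delta> ^ Suc k"
        by (simp add: mult_ac)
    qed
    have Dlim: "(\<lambda>K. \<Sum>n\<in>{2..2^K}. a n * real n powr - \<delta>) \<longlonglongrightarrow> D \<delta>"
    proof -
      have "(\<lambda>N. \<Sum>n\<le>N. a n * real n powr - \<delta>) \<longlonglongrightarrow> D \<delta>"
        unfolding D_def by (rule summable_LIMSEQ'[OF sm[OF that]])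
      moreover have "filterlim (\<lambda>K. 2 ^ K :: nat) at_top sequentially"
        by (rule filterlim_subseq) (auto simp: strict_mono_def)
      ultimately have "(\<lambda>K. \<Sum>n\<le>2 ^ K. a n * real n powr - \<delta>) \<longlonglongrightarrow> D \<delta>"
        by (rule filterlim_compose)
      moreover have "(\<Sum>n\<le>2 ^ K. a n * real n powr - \<delta>) = (\<Sum>n\<in>{2..2^K}. a n * real n powr - \<delta>)" for K
      proof (rule sum.mono_neutral_right)
        show "\<forall>n\<in>{..2 ^ K} - {2..2 ^ K}. a n * real n powr - \<delta> = 0"
        proof
          fix n :: nat assume "n \<in> {..2 ^ K} - {2..2 ^ K}"
          then have "n = 0 \<or> n = 1" by auto
          then show "a n * real n powr - \<delta> = 0" using zero by auto
        qed
      qed auto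
      ultimately show ?thesis by simp
    qed
    show "X \<delta> - ln (1 - r \<delta>) \<le> D \<delta>"
      by (rule LIMSEQ_le[OF A[unfolded sums_def] Dlim])
        (auto simp: blocks[symmetric] simp del: power_Suc intro!: sum_mono block)
    have "r \<delta> * D \<delta> \<le> X \<delta> - ln (1 - r \<delta>)"
      by (rule LIMSEQ_le[OF tendsto_mult_left[OF Dlim] A[unfolded sums_def]])
        (auto simp: blocks[symmetric] sum_distrib_left[of "r \<delta>" _ "{..<_}"] simp del: power_Suc intro!: sum_mono block)
    then show "D \<delta> \<le> (X \<delta> - ln (1 - r \<delta>)) / r \<delta>"
      using r[OF that] by (simp add: field_simps)
  qed
  \<comment> \<open>As \<open>1 - r \<delta>\<close> is asymptotic to
    \<open>\<delta> * ln 2\<close>, this limit cancels the \<open>ln (ln 2)\<close> contained in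
    \<open>Y\<close>.\<close>
  have l1: "((\<lambda>\<delta>. ln \<delta> - ln (1 - r \<delta>)) \<longlongrightarrow> - ln (ln 2)) (at_right 0)"
    unfolding r_def by real_asymp
  have l2: "((\<lambda>\<delta>. (1 / r \<delta> - 1) * ln (1 - r \<delta>)) \<longlongrightarrow> 0) (at_right 0)"
    unfolding r_def by real_asymp
  have l3: "((\<lambda>\<delta>. 1 / r \<delta> - 1) \<longlongrightarrow> 0) (at_right 0)"
    unfolding r_def by real_asymp
  have lower: "((\<lambda>\<delta>. X \<delta> + (ln \<delta> - ln (1 - r \<delta>))) \<longlongrightarrow> Y + - ln (ln 2)) (at_right 0)"
    by (intro tendsto_add X l1)
  \<comment> \<open>The upper bound is written as the lower bound plus a correction:
    \<open>1 / r \<delta> - 1\<close> vanishes fast enough to absorb the logarithmic growth of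
    \<open>ln (1 - r \<delta>)\<close>.\<close>
  have upper: "((\<lambda>\<delta>. X \<delta> + (ln \<delta> - ln (1 - r \<delta>)) + ((1 / r \<delta> - 1) * X \<delta> - (1 / r \<delta> - 1) * ln (1 - r \<delta>)))
      \<longlongrightarrow> Y + - ln (ln 2) + (0 * Y - 0)) (at_right 0)"
    by (intro tendsto_add tendsto_diff tendsto_mult X l1 l2 l3)
  have ev: "\<forall>\<^sub>F \<delta> in at_right 0. \<delta> > (0::real)" by (auto simp: eventually_at_right_less)
  have "((\<lambda>\<delta>. D \<delta> + ln \<delta>) \<longlongrightarrow> Y + - ln (ln 2)) (at_right 0)"
  proof (rule tendsto_sandwich[OF _ _ lower])
    show "\<forall>\<^sub>F \<delta> in at_right 0. X \<delta> + (ln \<delta> - ln (1 - r \<delta>)) \<le> D \<delta> + ln \<delta>"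
      using ev by eventually_elim (use bounds(1) in fastforce)
    show "\<forall>\<^sub>F \<delta> in at_right 0. D \<delta> + ln \<delta> \<le>
        X \<delta> + (ln \<delta> - ln (1 - r \<delta>)) + ((1 / r \<delta> - 1) * X \<delta> - (1 / r \<delta> - 1) * ln (1 - r \<delta>))"
      using ev
    proof eventually_elim
      case (elim \<delta>)
      have "X \<delta> + (ln \<delta> - ln (1 - r \<delta>)) + ((1 / r \<delta> - 1) * X \<delta> - (1 / r \<delta> - 1) * ln (1 - r \<delta>))
          = (X \<delta> - ln (1 - r \<delta>)) / r \<delta> + ln \<delta>"
        by (simp add: algebra_simps diff_divide_distrib)
      then show ?case using bounds(2)[OF elim] by simp
    qed
    show "((\<lambda>\<delta>. X \<delta> + (ln \<delta> - ln (1 - r \<delta>)) + ((1 / r \<delta> - 1) * X \<delta> - (1 / r \<delta> - 1) * ln (1 - r \<delta>)))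
      \<longlongrightarrow> Y + - ln (ln 2)) (at_right 0)" by (rule tendsto_eq_rhs[OF upper]) simp
  qed
  then show ?thesis by (simp add: Y_def D_def)
qed

subsection \<open>Euler products near s = 1\<close>

text \<open>Sieving by one more prime \<open>q\<close> removes the surviving multiples of
  \<open>q\<close>. Their sum is \<open>f q\<close> times the current sum, since divisibility by the
  earlier primes is unaffected by the factor \<open>q\<close>.\<close>

lemma sieve_suminf:
  fixes f :: "nat \<Rightarrow> real"
  assumes mult: "\<And>a b. f (a * b) = f a * f b" and sm: "summable (\<lambda>n. \<bar>f n\<bar>)"
    and P: "finite P" "\<And>p. p \<in> P \<Longrightarrow> prime p"
  shows "(\<lambda>n. if \<forall>p\<in>P. \<not> p dvd n then f n else 0) sums ((\<Prod>p\<in>P. 1 - f p) * suminf f)"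
  using P
proof (induction P rule: finite_induct)
  case empty
  show ?case using summable_rabs_cancel[OF sm] by (simp add: summable_sums)
next
  case (insert q P)
  define g where "g n = (if \<forall>p\<in>P. \<not> p dvd n then f n else 0)" for n
  define T where "T = (\<Prod>p\<in>P. 1 - f p) * suminf f"
  have q: "prime q" using insert by auto
  have g: "g sums T" using insert by (simp add: g_def[abs_def] T_def)
  have gq: "g (q * n) = f q * g n" for n
  proof -
    have "p dvd q * n \<longleftrightarrow> p dvd n" if "p \<in> P" for p
    proof -
      have p: "prime p" "p \<noteq> q" using that insert by auto
      then have "\<not> p dvd q" using q primes_dvd_imp_eq by blast
      then show ?thesis using p by (simp add: prime_dvd_mult_iff)
    qed
    then show ?thesis by (simp add: g_def mult)
  qed
  have "(\<lambda>n. g (q * n)) sums (f q * T)" unfolding gq by (intro sums_mult g)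
  then have "(\<lambda>n. if q dvd q * n then g (q * n) else 0) sums (f q * T)" by simp
  then have "(\<lambda>n. if q dvd n then g n else 0) sums (f q * T)"
  proof (subst (asm) sums_mono_reindex[of "\<lambda>n. q * n" "\<lambda>n. if q dvd n then g n else 0"])
    show "strict_mono (\<lambda>n. q * n)" using prime_gt_0_nat[OF q] by (auto simp: strict_mono_def)
  qed auto
  then have "(\<lambda>n. g n - (if q dvd n then g n else 0)) sums (T - f q * T)"
    by (intro sums_diff g)
  moreover have "g n - (if q dvd n then g n else 0) = (if \<forall>p\<in>insert q P. \<not> p dvd n then f n else 0)" for n
    by (auto simp: g_def)
  moreover have "T - f q * T = (\<Prod>p\<in>insert q P. 1 - f p) * suminf f"
    using insert by (simp add: T_def algebra_simps)
  ultimately show ?case by simp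
qed

text \<open>After sieving by all primes up to \<open>N \<ge> n\<close>, an index
  \<open>n > 1\<close> is gone, so only the term at 1 remains in the limit; dominated convergence
  justifies the exchange. The product form does not presuppose that the sum is nonzero, which is
  deduced from it later.\<close>

lemma euler_product:
  fixes f :: "nat \<Rightarrow> real"
  assumes mult: "\<And>a b. f (a * b) = f a * f b" and sm: "summable (\<lambda>n. \<bar>f n\<bar>)"
    and f0: "f 0 = 0" and f1: "f 1 = 1"
  shows "(\<lambda>N. (\<Prod>p | prime p \<and> p \<le> N. 1 - f p) * suminf f) \<longlonglongrightarrow> 1"
proof -
  define h where "h n N = (if \<forall>p\<in>{p. prime p \<and> p \<le> N}. \<not> p dvd n then f n else 0)" for n N :: nat
  have fin: "finite {p. prime p \<and> p \<le> N}" for N :: nat by simp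
  have eq: "(\<Prod>p | prime p \<and> p \<le> N. 1 - f p) * suminf f = (\<Sum>n. h n N)" for N
    unfolding h_def by (rule sums_unique[OF sieve_suminf[OF mult sm fin]]) auto
  have "(\<lambda>N. \<Sum>n. h n N) \<longlonglongrightarrow> (\<Sum>n. if n = 1 then 1 else 0)"
  proof (rule conjunct2[OF conjunct2[OF tannerys_theorem]])
    show "(\<lambda>N. h n N) \<longlonglongrightarrow> (if n = 1 then 1 else 0)" for n
    proof (rule tendsto_eventually)
      show "\<forall>\<^sub>F N in sequentially. h n N = (if n = 1 then 1 else 0)"
        using eventually_ge_at_top[of n]
      proof eventually_elim
        case (elim N)
        consider "n = 0" | "n = 1" | "n > 1" by linarith
        then show ?case
        proof cases
          case 3
          then obtain p where "prime p" "p dvd n" using prime_factor_nat[of n] by auto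
          moreover have "p \<le> N" using \<open>p dvd n\<close> 3 elim by (auto dest: dvd_imp_le)
          ultimately show ?thesis using 3 by (auto simp: h_def)
        qed (use f0 f1 in \<open>auto simp: h_def\<close>)
      qed
    qed
    show "\<forall>\<^sub>F (n, N) in at_top \<times>\<^sub>F sequentially. norm (h n N) \<le> \<bar>f n\<bar>"
      by (intro always_eventually) (auto simp: h_def)
  qed (use sm in auto)
  also have "(\<Sum>n. if n = (1::nat) then 1 else 0) = (1::real)"
    using sums_single[of 1 "\<lambda>_. 1::real"] by (simp add: sums_iff)
  finally show ?thesis unfolding eq .
qed

section \<open>Behaviour of the zeta series and the L-series as s decreases to 1\<close>

lemma summable_powr_neg: "s > 1 \<Longrightarrow> summable (\<lambda>n. real n powr - s)"
  using summable_real_powr_iff[of "-s"] by simp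

lemma summable_chi4_powr:
  assumes "s > 1"
  shows "summable (\<lambda>n. \<bar>chi4 n * real n powr - s\<bar>)"
proof (rule summable_comparison_test'[OF summable_powr_neg[OF assms]])
  show "norm \<bar>chi4 n * real n powr - s\<bar> \<le> real n powr - s" for n
    using mult_right_mono[OF abs_chi4_le[of n], of "real n powr - s"] by (simp add: abs_mult)
qed

text \<open>At s = 1 the series converges only conditionally, so dominated convergence fails;
  \<open>abel_limit\<close> is applied to Leibniz's series with weights
  \<open>real (Suc k) powr - \<delta>\<close>.\<close>

lemma tendsto_suminf_chi4_powr:
  "((\<lambda>\<delta>. \<Sum>n. chi4 n * real n powr - (1 + \<delta>)) \<longlongrightarrow> pi / 4) (at_right 0)"
proof -
  define c where "c k = chi4 (Suc k) * (1 / Suc k)" for k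
  have c: "c sums (pi / 4)" unfolding c_def by (rule chi4_over_n_sums)
  have c_powr: "c k * real (Suc k) powr - \<delta> = chi4 (Suc k) * real (Suc k) powr - (1 + \<delta>)" for k \<delta>
    using powr_add[of "real (Suc k)" "-1" "-\<delta>"] by (simp add: c_def powr_neg_one)
  have sm: "summable (\<lambda>n. chi4 n * real n powr - (1 + \<delta>))" if "\<delta> > 0" for \<delta>
    using summable_rabs_cancel[OF summable_chi4_powr[of "1 + \<delta>"]] that by simp
  have ev: "\<forall>\<^sub>F \<delta> in at_right 0. \<delta> > (0::real)" by (auto simp: eventually_at_right_less)
  have "((\<lambda>\<delta>. \<Sum>k. c k * real (Suc k) powr - \<delta>) \<longlongrightarrow> suminf c) (at_right 0)"
  proof (rule abel_limit)
    show "summable c" using c by (simp add: sums_iff)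
    show "\<forall>\<^sub>F \<delta> in at_right 0. antimono (\<lambda>k. real (Suc k) powr - \<delta>) \<and>
        (\<forall>k. 0 \<le> real (Suc k) powr - \<delta> \<and> real (Suc k) powr - \<delta> \<le> 1) \<and>
        summable (\<lambda>k. c k * real (Suc k) powr - \<delta>)"
      using ev
    proof eventually_elim
      case (elim \<delta>)
      have "antimono (\<lambda>k. real (Suc k) powr - \<delta>)"
        unfolding antimono_def using elim by (auto intro!: powr_mono2')
      moreover have "real (Suc k) powr - \<delta> \<le> 1" for k
        using powr_mono2'[of "-\<delta>" 1 "real (Suc k)"] elim by simp
      moreover have "summable (\<lambda>k. c k * real (Suc k) powr - \<delta>)"
        unfolding c_powr by (subst summable_Suc_iff[of "\<lambda>n. chi4 n * real n powr - (1 + \<delta>)"]) (rule sm[OF elim])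
      ultimately show ?case by simp
    qed
    have "((\<lambda>\<delta>. real (Suc k) powr - \<delta>) \<longlongrightarrow> real (Suc k) powr - 0) (at_right 0)" for k
      by (intro tendsto_powr tendsto_minus tendsto_const tendsto_ident_at) auto
    then show "((\<lambda>\<delta>. real (Suc k) powr - \<delta>) \<longlongrightarrow> 1) (at_right 0)" for k by simp
  qed
  then have "((\<lambda>\<delta>. \<Sum>k. c k * real (Suc k) powr - \<delta>) \<longlongrightarrow> pi / 4) (at_right 0)"
    unfolding sums_unique[OF c] .
  moreover have "\<forall>\<^sub>F \<delta> in at_right 0. (\<Sum>k. c k * real (Suc k) powr - \<delta>) = (\<Sum>n. chi4 n * real n powr - (1 + \<delta>))"
    using ev
  proof eventually_elim
    case (elim \<delta>)
    show ?case unfolding c_powr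
      using suminf_split_head[OF sm[OF elim]] by simp
  qed
  ultimately show ?thesis by (rule Lim_transform_eventually)
qed

lemma powr_diff_bounds:
  fixes x \<delta> :: real
  assumes "x > 0" "\<delta> > 0"
  shows "\<delta> * (x + 1) powr - (1 + \<delta>) \<le> x powr - \<delta> - (x + 1) powr - \<delta>"
    and "x powr - \<delta> - (x + 1) powr - \<delta> \<le> \<delta> * x powr - (1 + \<delta>)"
proof -
  have "\<exists>z>x. z < x + 1 \<and> (x + 1) powr - \<delta> - x powr - \<delta> = (x + 1 - x) * (- \<delta> * z powr (- \<delta> - 1))"
    by (rule MVT2) (use assms in \<open>auto intro!: derivative_eq_intros\<close>)
  then obtain z where z: "x < z" "z < x + 1"
    and "(x + 1) powr - \<delta> - x powr - \<delta> = (x + 1 - x) * (- \<delta> * z powr (- \<delta> - 1))"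
    by blast
  then have "x powr - \<delta> - (x + 1) powr - \<delta> = - ((x + 1 - x) * (- \<delta> * z powr (- \<delta> - 1)))"
    by (metis minus_diff_eq)
  also have "- \<delta> - 1 = - (1 + \<delta>)" by simp
  finally have eq: "x powr - \<delta> - (x + 1) powr - \<delta> = \<delta> * z powr - (1 + \<delta>)" by simp
  have "(x + 1) powr - (1 + \<delta>) \<le> z powr - (1 + \<delta>)" "z powr - (1 + \<delta>) \<le> x powr - (1 + \<delta>)"
    using z assms by (auto intro!: powr_mono2')
  then show "\<delta> * (x + 1) powr - (1 + \<delta>) \<le> x powr - \<delta> - (x + 1) powr - \<delta>"
    "x powr - \<delta> - (x + 1) powr - \<delta> \<le> \<delta> * x powr - (1 + \<delta>)"
    unfolding eq using assms by auto
qed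

text \<open>The integral test in telescoped form: the differences of
  \<open>x powr - \<delta>\<close> at consecutive integers sum to 1 and are enclosed by
  \<open>powr_diff_bounds\<close>. This is the residue 1 of zeta at s = 1.\<close>

lemma suminf_powr_bounds:
  fixes \<delta> :: real
  assumes "\<delta> > 0"
  shows "1 \<le> \<delta> * (\<Sum>n. real n powr - (1 + \<delta>))" "\<delta> * (\<Sum>n. real n powr - (1 + \<delta>)) \<le> 1 + \<delta>"
proof -
  let ?Z = "\<Sum>n. real n powr - (1 + \<delta>)"
  have sm: "summable (\<lambda>n. real n powr - (1 + \<delta>))" using summable_powr_neg[of "1 + \<delta>"] assms by simp
  \<comment> \<open>The term at 0 may be dropped because \<open>0 powr a = 0\<close>; the next shift
    drops the term at 1, which is 1.\<close>
  have Z1: "(\<lambda>n. real (Suc n) powr - (1 + \<delta>)) sums ?Z"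
    using summable_sums[OF sm] by (subst sums_Suc_iff) simp
  then have Z2: "(\<lambda>n. real (Suc (Suc n)) powr - (1 + \<delta>)) sums (?Z - 1)"
    by (subst sums_Suc_iff[of "\<lambda>n. real (Suc n) powr - (1 + \<delta>)"]) simp
  have "(\<lambda>n. real (Suc n) powr - \<delta>) \<longlonglongrightarrow> 0" using assms by real_asymp
  then have T: "(\<lambda>n. real (Suc n) powr - \<delta> - real (Suc (Suc n)) powr - \<delta>) sums 1"
    using telescope_sums'[of "\<lambda>n. real (Suc n) powr - \<delta>" 0] by simp
  have "real (Suc (Suc n)) = real (Suc n) + 1" for n by simp
  note b = powr_diff_bounds[of "real (Suc n)" \<delta> for n, folded this]
  show "1 \<le> \<delta> * ?Z"
    by (rule sums_le[OF _ T sums_mult[OF Z1]]) (use b(2) assms in simp)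
  have "\<delta> * (?Z - 1) \<le> 1"
    by (rule sums_le[OF _ sums_mult[OF Z2] T]) (use b(1) assms in simp)
  then show "\<delta> * ?Z \<le> 1 + \<delta>" by (simp add: algebra_simps)
qed

lemma tendsto_mult_suminf_powr:
  "((\<lambda>\<delta>. \<delta> * (\<Sum>n. real n powr - (1 + \<delta>))) \<longlongrightarrow> 1) (at_right 0)"
proof (rule tendsto_sandwich)
  have ev: "\<forall>\<^sub>F \<delta> in at_right 0. \<delta> > (0::real)" by (auto simp: eventually_at_right_less)
  show "\<forall>\<^sub>F \<delta> in at_right 0. 1 \<le> \<delta> * (\<Sum>n. real n powr - (1 + \<delta>))"
    using ev by eventually_elim (rule suminf_powr_bounds)
  show "\<forall>\<^sub>F \<delta> in at_right 0. \<delta> * (\<Sum>n. real n powr - (1 + \<delta>)) \<le> 1 + \<delta>"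
    using ev by eventually_elim (rule suminf_powr_bounds)
  show "((\<lambda>\<delta>. 1 + \<delta>) \<longlongrightarrow> 1) (at_right (0::real))" by real_asymp
qed simp

text \<open>Logarithms of the Euler products of zeta and L are compared. The factors at primes 1 mod
  4 cancel, those at primes 3 mod 4 give the summands, and the factor of zeta at 2 accounts for
  \<open>ln (1 - 2 powr - s)\<close>.\<close>

lemma prime3_sums:
  assumes "s > 1"
  defines "Z \<equiv> \<Sum>n. real n powr - s" and "L \<equiv> \<Sum>n. chi4 n * real n powr - s"
  shows "Z > 0" "L > 0"
    and "(\<lambda>n. prime3 n * (ln (1 + real n powr - s) - ln (1 - real n powr - s)))
      sums (ln Z - ln L + ln (1 - 2 powr - s))"
proof -
  let ?P = "\<lambda>N. {p. prime p \<and> p \<le> N}"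
  define PZ where "PZ N = (\<Prod>p\<in>?P N. 1 - real p powr - s)" for N :: nat
  define PL where "PL N = (\<Prod>p\<in>?P N. 1 - chi4 p * real p powr - s)" for N
  have x: "real p powr - s < 1" if "prime p" for p
  proof -
    have "real p powr - s < 1 powr - s"
      using that assms prime_gt_1_nat[OF that] by (intro powr_less_mono2_neg) auto
    then show ?thesis by simp
  qed
  have cx: "chi4 p * real p powr - s < 1" if "prime p" for p
    using mult_right_mono[of "chi4 p" 1 "real p powr - s"] abs_chi4_le[of p] x[OF that] by (simp add: abs_le_iff)
  have PZ_pos: "PZ N > 0" for N unfolding PZ_def using x by (intro prod_pos) auto
  have PL_pos: "PL N > 0" for N unfolding PL_def using cx by (intro prod_pos) auto
  have limZ: "(\<lambda>N. PZ N * Z) \<longlonglongrightarrow> 1"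
    unfolding PZ_def Z_def
    by (rule euler_product) (use summable_powr_neg[OF assms(1)] in \<open>auto simp: powr_mult\<close>)
  have limL: "(\<lambda>N. PL N * L) \<longlonglongrightarrow> 1"
    unfolding PL_def L_def
    by (rule euler_product) (use summable_chi4_powr[OF assms(1)] in \<open>auto simp: powr_mult chi4_mult\<close>)
  \<comment> \<open>The finite products are positive and their multiples by \<open>Z\<close> tend to
    1, which forces \<open>Z\<close> to be positive; the same works for \<open>L\<close>.\<close>
  have "\<forall>\<^sub>F N in sequentially. PZ N * Z > 0" using limZ by (rule order_tendstoD) simp
  then have "\<exists>N. PZ N * Z > 0" by (rule eventually_happens'[OF sequentially_bot])
  then show Z: "Z > 0" using PZ_pos zero_less_mult_pos by blast
  have "\<forall>\<^sub>F N in sequentially. PL N * L > 0" using limL by (rule order_tendstoD) simp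
  then have "\<exists>N. PL N * L > 0" by (rule eventually_happens'[OF sequentially_bot])
  then show L: "L > 0" using PL_pos zero_less_mult_pos by blast
  define t where "t n = prime3 n * (ln (1 + real n powr - s) - ln (1 - real n powr - s))" for n
  have t: "ln (1 - chi4 p * real p powr - s) - ln (1 - real p powr - s)
      = t p - (if p = 2 then ln (1 - 2 powr - s) else 0)" if p: "prime p" for p
  proof (cases "p = 2")
    case True
    then show ?thesis by (simp add: chi4_def t_def prime3_def)
  next
    case False
    then have "odd p" using p prime_ge_2_nat[OF p] prime_odd_nat[of p] by auto
    then have "p mod 4 = 1 \<or> p mod 4 = 3" by presburger
    then show ?thesis using False p by (auto simp: chi4_def t_def prime3_def)
  qed
  have eq: "ln (PL N * L) - ln (PZ N * Z) + (ln Z - ln L + ln (1 - 2 powr - s)) = (\<Sum>n\<le>N. t n)" if N: "N \<ge> 2" for N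
  proof -
    have "ln (PL N) - ln (PZ N) = (\<Sum>p\<in>?P N. ln (1 - chi4 p * real p powr - s) - ln (1 - real p powr - s))"
    proof -
      have "ln (PL N) = (\<Sum>p\<in>?P N. ln (1 - chi4 p * real p powr - s))"
        unfolding PL_def using cx by (intro ln_prod) (auto simp: less_imp_neq)
      moreover have "ln (PZ N) = (\<Sum>p\<in>?P N. ln (1 - real p powr - s))"
        unfolding PZ_def using x by (intro ln_prod) (auto simp: less_imp_neq)
      ultimately show ?thesis by (simp add: sum_subtractf)
    qed
    also have "\<dots> = (\<Sum>p\<in>?P N. t p - (if p = 2 then ln (1 - 2 powr - s) else 0))"
      using t by (intro sum.cong) auto
    also have "\<dots> = (\<Sum>p\<in>?P N. t p) - ln (1 - 2 powr - s)"
      using N by (simp add: sum_subtractf sum.delta)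
    also have "(\<Sum>p\<in>?P N. t p) = (\<Sum>n\<le>N. t n)"
      by (rule sum.mono_neutral_left) (auto simp: t_def prime3_def)
    finally show ?thesis using Z L PL_pos[of N] PZ_pos[of N] by (simp add: ln_mult)
  qed
  have ev: "\<forall>\<^sub>F N in sequentially. ln (PL N * L) - ln (PZ N * Z) + (ln Z - ln L + ln (1 - 2 powr - s)) = (\<Sum>n\<le>N. t n)"
    by (rule eventually_mono[OF eventually_ge_at_top[of 2] eq])
  have "(\<lambda>N. ln (PL N * L) - ln (PZ N * Z) + (ln Z - ln L + ln (1 - 2 powr - s)))
      \<longlonglongrightarrow> ln 1 - ln 1 + (ln Z - ln L + ln (1 - 2 powr - s))"
    by (intro tendsto_intros limZ limL) auto
  then have "(\<lambda>N. \<Sum>n\<le>N. t n) \<longlonglongrightarrow> ln 1 - ln 1 + (ln Z - ln L + ln (1 - 2 powr - s))"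
    using ev by (rule Lim_transform_eventually)
  then show "(\<lambda>n. prime3 n * (ln (1 + real n powr - s) - ln (1 - real n powr - s)))
      sums (ln Z - ln L + ln (1 - 2 powr - s))"
    by (simp add: sums_def_le t_def)
qed

subsection \<open>The Mertens constant for the primes congruent to 3 mod 4\<close>

text \<open>What remains of ln ((1 + x) / (1 - x)) after its linear term. Being quadratically small,
  it is summed over the primes without trouble up to and including s = 1.\<close>

definition ln_ratio_rem :: "real \<Rightarrow> real" where
  "ln_ratio_rem x = ln (1 + x) - ln (1 - x) - 2 * x"

lemma abs_ln_ratio_rem_le:
  assumes "\<bar>x\<bar> \<le> 1/2"
  shows "\<bar>ln_ratio_rem x\<bar> \<le> 4 * x\<^sup>2"
proof -
  have "\<bar>ln (1 + x) - x\<bar> \<le> 2 * x\<^sup>2" "\<bar>ln (1 + -x) - -x\<bar> \<le> 2 * (-x)\<^sup>2"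
    by (rule abs_ln_one_plus_x_minus_x_bound; use assms in simp)+
  then show ?thesis by (simp add: ln_ratio_rem_def abs_le_iff)
qed

lemma prime3_ge: "prime3 n \<noteq> 0 \<Longrightarrow> n \<ge> 3"
  by (auto simp: prime3_def split: if_splits)

lemma abs_prime3_le: "\<bar>prime3 n\<bar> \<le> 1" and prime3_nonneg: "prime3 n \<ge> 0"
  by (simp_all add: prime3_def)

lemma powr_neg_le_inverse:
  assumes "n \<ge> 1" "s \<ge> 1"
  shows "real n powr - s \<le> 1 / n"
proof -
  have "real n powr - s \<le> real n powr - 1" using assms by (intro powr_mono) auto
  then show ?thesis using assms by (simp add: powr_neg_one)
qed

text \<open>The majorant is independent of \<open>s\<close>, so it serves both for summability and
  for passing to the limit at 1. The primes in question are at least 3, which keeps the argument of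
  \<open>ln_ratio_rem\<close> below 1/2.\<close>

lemma prime3_rem_bound:
  assumes "s \<ge> 1"
  shows "\<bar>prime3 n * ln_ratio_rem (real n powr - s)\<bar> \<le> 4 * (1 / (real n)\<^sup>2)"
proof (cases "prime3 n = 0")
  case False
  then have n: "n \<ge> 3" by (rule prime3_ge)
  have x: "real n powr - s \<le> 1 / n" using n assms by (intro powr_neg_le_inverse) auto
  also have "1 / real n \<le> 1 / 2" using n by (intro divide_left_mono) auto
  finally have "\<bar>real n powr - s\<bar> \<le> 1/2" by simp
  then have "\<bar>ln_ratio_rem (real n powr - s)\<bar> \<le> 4 * (real n powr - s)\<^sup>2" by (rule abs_ln_ratio_rem_le)
  also have "(real n powr - s)\<^sup>2 \<le> (1 / n)\<^sup>2" using x by (intro power_mono) auto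
  finally have "\<bar>ln_ratio_rem (real n powr - s)\<bar> \<le> 4 * (1 / (real n)\<^sup>2)" by (simp add: power_one_over)
  then show ?thesis
    using mult_mono[OF abs_prime3_le[of n], of "\<bar>ln_ratio_rem (real n powr - s)\<bar>" "4 * (1 / (real n)\<^sup>2)"]
    by (simp add: abs_mult)
qed simp

lemma summable_inverse_square: "summable (\<lambda>n. 4 * (1 / (real n)\<^sup>2))"
  using inverse_power_summable[of 2, where ?'a = real]
  by (intro summable_mult) (simp add: inverse_eq_divide)

text \<open>The linear part of the logarithm is handled by partial summation, which yields a limit
  \<open>C\<close> without its value. The value follows by computing the limit of
  \<open>D \<delta> + ln \<delta>\<close> twice, once through \<open>abel_ln_ln\<close> and once
  through the Euler products; the constant \<open>H 1\<close> of the remainder is then added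
  back.\<close>

lemma prime3_mertens:
  "(\<lambda>N. (\<Sum>n\<le>N. prime3 n * (ln (1 + 1 / n) - ln (1 - 1 / n))) - ln (ln N))
    \<longlonglongrightarrow> euler_mascheroni + ln (2 / pi)"
proof -
  define a where "a n = 2 * prime3 n / n" for n
  define H where "H s = (\<Sum>n. prime3 n * ln_ratio_rem (real n powr - s))" for s
  define D where "D \<delta> = (\<Sum>n. a n * real n powr - \<delta>)" for \<delta>
  define Z where "Z \<delta> = (\<Sum>n. real n powr - (1 + \<delta>))" for \<delta>
  define L where "L \<delta> = (\<Sum>n. chi4 n * real n powr - (1 + \<delta>))" for \<delta>
  have ev: "\<forall>\<^sub>F \<delta> in at_right 0. \<delta> > (0::real)" by (auto simp: eventually_at_right_less)
  have Hsm: "summable (\<lambda>n. prime3 n * ln_ratio_rem (real n powr - s))" if "s \<ge> 1" for s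
    by (rule summable_comparison_test'[OF summable_inverse_square]) (use prime3_rem_bound[OF that] in simp)
  have a_powr: "a n * real n powr - \<delta> = 2 * prime3 n * real n powr - (1 + \<delta>)" for n \<delta>
    using powr_add[of "real n" "-1" "-\<delta>"] by (simp add: a_def powr_neg_one prime3_def)
  have a_sm: "summable (\<lambda>n. a n * real n powr - \<delta>)" if "\<delta> > 0" for \<delta>
  proof (rule summable_comparison_test')
    show "summable (\<lambda>n. 2 * real n powr - (1 + \<delta>))"
      using summable_powr_neg[of "1 + \<delta>"] that by (intro summable_mult) simp
    show "norm (a n * real n powr - \<delta>) \<le> 2 * real n powr - (1 + \<delta>)" for n
      unfolding a_powr using abs_prime3_le[of n] by (simp add: abs_mult mult_left_le_one_le)
  qed

  obtain B where B: "\<And>N. N \<ge> 1 \<Longrightarrow> \<bar>(\<Sum>n\<in>{1..N}. 2 * prime3 n * ln n / n) - ln N\<bar> \<le> B"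
    using sum_prime3_ln by auto
  obtain C where "(\<lambda>N. (\<Sum>n\<in>{2..N}. 2 * prime3 n * ln n / n / ln n) - ln (ln N)) \<longlonglongrightarrow> C"
    using convergent_sum_over_ln[OF B] by (auto simp: convergent_def)
  also have "(\<lambda>N. (\<Sum>n\<in>{2..N}. 2 * prime3 n * ln n / n / ln n)) = (\<lambda>N. \<Sum>n\<in>{2..N}. a n)"
    by (intro ext sum.cong) (auto simp: a_def)
  finally have C: "(\<lambda>N. (\<Sum>n\<in>{2..N}. a n) - ln (ln N)) \<longlonglongrightarrow> C" .

  have lim1: "((\<lambda>\<delta>. D \<delta> + ln \<delta>) \<longlongrightarrow> C - euler_mascheroni) (at_right 0)"
    unfolding D_def
    by (rule abel_ln_ln[OF _ _ _ C a_sm]) (auto simp: a_def prime3_nonneg prime3_def)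

  have limH: "((\<lambda>\<delta>. H (1 + \<delta>)) \<longlongrightarrow> H 1) (at_right 0)"
    unfolding H_def
  proof (rule conjunct2[OF conjunct2[OF tannerys_theorem]])
    have bound: "norm (prime3 n * ln_ratio_rem (real n powr - (1 + \<delta>))) \<le> 4 * (1 / (real n)\<^sup>2)"
      if "\<delta> > 0" for n \<delta>
      using prime3_rem_bound[of "1 + \<delta>" n] that by simp
    show "\<forall>\<^sub>F (n, \<delta>) in at_top \<times>\<^sub>F at_right 0.
        norm (prime3 n * ln_ratio_rem (real n powr - (1 + \<delta>))) \<le> 4 * (1 / (real n)\<^sup>2)"
      unfolding eventually_prod_filter
      by (rule exI[of _ "\<lambda>_. True"], rule exI[of _ "\<lambda>\<delta>. \<delta> > 0"])
        (use ev bound in auto)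
    show "((\<lambda>\<delta>. prime3 n * ln_ratio_rem (real n powr - (1 + \<delta>))) \<longlongrightarrow>
        prime3 n * ln_ratio_rem (real n powr - 1)) (at_right 0)" for n
    proof (cases "prime3 n = 0")
      case False
      then have n: "n \<ge> 3" by (rule prime3_ge)
      have x: "((\<lambda>\<delta>. real n powr - (1 + \<delta>)) \<longlongrightarrow> real n powr - (1 + 0)) (at_right 0)"
        using n by (intro tendsto_intros) auto
      have "0 < real n powr - 1" "real n powr - 1 < 1" using n by (auto simp: powr_neg_one)
      then have "1 + real n powr - 1 \<noteq> 0" "1 - real n powr - 1 \<noteq> 0" by linarith+
      then show ?thesis unfolding ln_ratio_rem_def
        by (intro tendsto_mult tendsto_diff tendsto_ln tendsto_add tendsto_const x[unfolded add_0_right])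
    qed simp
  qed (use summable_inverse_square in auto)

  have D_eq: "D \<delta> = ln (Z \<delta>) - ln (L \<delta>) + ln (1 - 2 powr - (1 + \<delta>)) - H (1 + \<delta>)" if "\<delta> > 0" for \<delta>
  proof -
    have "(\<lambda>n. prime3 n * (ln (1 + real n powr - (1 + \<delta>)) - ln (1 - real n powr - (1 + \<delta>)))
        - prime3 n * ln_ratio_rem (real n powr - (1 + \<delta>)))
        sums (ln (Z \<delta>) - ln (L \<delta>) + ln (1 - 2 powr - (1 + \<delta>)) - H (1 + \<delta>))"
      unfolding Z_def L_def H_def using that
      by (intro sums_diff prime3_sums summable_sums Hsm) auto
    also have "(\<lambda>n. prime3 n * (ln (1 + real n powr - (1 + \<delta>)) - ln (1 - real n powr - (1 + \<delta>)))
        - prime3 n * ln_ratio_rem (real n powr - (1 + \<delta>))) = (\<lambda>n. a n * real n powr - \<delta>)"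
      unfolding a_powr ln_ratio_rem_def by (simp add: algebra_simps)
    finally show ?thesis unfolding D_def by (rule sums_unique[symmetric])
  qed
  \<comment> \<open>Adding \<open>ln \<delta>\<close> to \<open>D \<delta>\<close> replaces
    \<open>Z \<delta>\<close> by \<open>\<delta> * Z \<delta>\<close>, which tends to 1.\<close>
  have "((\<lambda>\<delta>. ln (\<delta> * Z \<delta>) - ln (L \<delta>) + ln (1 - 2 powr - (1 + \<delta>)) - H (1 + \<delta>))
      \<longlongrightarrow> ln 1 - ln (pi / 4) + ln (1 / 2) - H 1) (at_right 0)"
  proof (intro tendsto_add tendsto_diff tendsto_ln limH)
    show "((\<lambda>\<delta>. \<delta> * Z \<delta>) \<longlongrightarrow> 1) (at_right 0)" unfolding Z_def by (rule tendsto_mult_suminf_powr)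
    show "(L \<longlongrightarrow> pi / 4) (at_right 0)" unfolding L_def by (rule tendsto_suminf_chi4_powr)
    show "((\<lambda>\<delta>. 1 - 2 powr - (1 + \<delta>)) \<longlongrightarrow> 1 / 2) (at_right (0::real))"
      by (auto intro!: tendsto_eq_intros simp: powr_neg_one)
  qed auto
  moreover have "\<forall>\<^sub>F \<delta> in at_right 0. ln (\<delta> * Z \<delta>) - ln (L \<delta>) + ln (1 - 2 powr - (1 + \<delta>)) - H (1 + \<delta>) = D \<delta> + ln \<delta>"
    using ev
  proof eventually_elim
    case (elim \<delta>)
    have "Z \<delta> > 0" unfolding Z_def using elim by (intro prime3_sums) auto
    then show ?case unfolding D_eq[OF elim] using elim by (simp add: ln_mult)
  qed
  ultimately have lim2: "((\<lambda>\<delta>. D \<delta> + ln \<delta>) \<longlongrightarrow> ln 1 - ln (pi / 4) + ln (1 / 2) - H 1) (at_right 0)"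
    by (rule Lim_transform_eventually)
  have "C - euler_mascheroni = ln 1 - ln (pi / 4) + ln (1 / 2) - H 1"
    by (rule tendsto_unique[OF _ lim1 lim2]) simp
  moreover have "ln 1 - ln (pi / 4) + ln (1 / 2) = ln (2 / pi)"
    using ln_mult[of 2 "2::real"] by (simp add: ln_div)
  ultimately have CH: "C + H 1 = euler_mascheroni + ln (2 / pi)" by linarith

  have "(\<lambda>N. (\<Sum>n\<in>{2..N}. a n) - ln (ln N) + (\<Sum>n\<le>N. prime3 n * ln_ratio_rem (real n powr - 1)))
      \<longlonglongrightarrow> C + H 1"
    unfolding H_def by (intro tendsto_add C summable_LIMSEQ' Hsm) simp
  moreover have "(\<Sum>n\<in>{2..N}. a n) + (\<Sum>n\<le>N. prime3 n * ln_ratio_rem (real n powr - 1))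
      = (\<Sum>n\<le>N. prime3 n * (ln (1 + 1 / n) - ln (1 - 1 / n)))" for N
  proof -
    have "(\<Sum>n\<in>{2..N}. a n) = (\<Sum>n\<le>N. a n)"
    proof (rule sum.mono_neutral_left)
      show "\<forall>n\<in>{..N} - {2..N}. a n = 0"
        using prime3_ge by (force simp: a_def)
    qed auto
    moreover have "a n + prime3 n * ln_ratio_rem (real n powr - 1)
        = prime3 n * (ln (1 + 1 / n) - ln (1 - 1 / n))" for n
      by (simp add: a_def ln_ratio_rem_def powr_neg_one' algebra_simps)
    ultimately show ?thesis by (simp add: sum.distrib[symmetric])
  qed
  ultimately show ?thesis unfolding CH[symmetric] by (simp add: algebra_simps)
qed

section \<open>Assembling the quotient and evaluating its limit\<close>

theorem theorem4p1:
  shows "convergent (\<lambda>n. calM n / calL n) \<and>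
         (\<lambda>n. calM n / calL n) \<longlonglongrightarrow> (1/2) * sqrt (pi / exp euler_mascheroni)"
proof -
  \<comment> \<open>ln (1 + x) is half the sum of ln (1 + x) - ln (1 - x) and ln (1 - x^2).
    \<open>E\<close> collects the first part, governed by \<open>prime3_mertens\<close>;
    \<open>S\<close> collects the second, whose convergent sum also determines
    \<open>LR_beta\<close>.\<close>
  define E where "E N = (\<Sum>n\<le>N. prime3 n * (ln (1 + 1 / n) - ln (1 - 1 / n)))" for N :: nat
  define l where "l n = prime3 n * ln (1 - 1 / (real n)\<^sup>2)" for n
  define S where "S N = (\<Sum>n\<le>N. l n)" for N
  have sq: "0 < 1 - 1 / (real n)\<^sup>2" if "n \<ge> 3" for n
  proof -
    have "1 / (real n)\<^sup>2 < 1 / 1\<^sup>2" using that by (intro divide_strict_left_mono power_strict_mono) auto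
    then show ?thesis by simp
  qed
  have l_eq: "l n = prime3 n * (ln (1 + 1 / n) + ln (1 - 1 / n))" for n
  proof (cases "prime3 n = 0")
    case False
    then have n: "n \<ge> 3" by (rule prime3_ge)
    have "1 - 1 / (real n)\<^sup>2 = (1 + 1 / n) * (1 - 1 / n)"
      using n by (simp add: field_simps power2_eq_square)
    moreover have "1 + 1 / real n > 0" "1 - 1 / real n > 0" using n by (auto simp: add_pos_pos)
    ultimately have "ln (1 - 1 / (real n)\<^sup>2) = ln (1 + 1 / n) + ln (1 - 1 / n)" by (simp only: ln_mult_pos)
    then show ?thesis by (simp only: l_def)
  qed (simp add: l_def)
  have l_sm: "summable l"
  proof (rule summable_comparison_test'[OF summable_inverse_square])
    fix n
    show "norm (l n) \<le> 4 * (1 / (real n)\<^sup>2)"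
    proof (cases "prime3 n = 0")
      case False
      then have n: "n \<ge> 3" by (rule prime3_ge)
      define x where "x = 1 / (real n)\<^sup>2"
      have "x \<le> 1 / 2\<^sup>2" unfolding x_def using n by (intro divide_left_mono power_mono) auto
      moreover have "0 \<le> x" by (simp add: x_def)
      moreover from calculation have "x\<^sup>2 \<le> x"
        by (simp add: power2_eq_square mult_left_le_one_le)
      ultimately have "- x - 2 * x\<^sup>2 \<le> ln (1 - x)" "ln (1 - x) \<le> - x" "x\<^sup>2 \<le> x"
        by (auto intro!: ln_one_minus_pos_lower_bound ln_one_minus_pos_upper_bound)
      then have "\<bar>ln (1 - x)\<bar> \<le> 4 * x" using \<open>0 \<le> x\<close> by linarith
      then show ?thesis using mult_mono[OF abs_prime3_le[of n], of "\<bar>ln (1 - x)\<bar>" "4 * x"]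
        by (simp add: l_def x_def abs_mult)
    qed (simp add: l_def)
  qed
  have beta: "LR_beta = exp (- suminf l / 2) / sqrt 2"
  proof -
    \<comment> \<open>The infinite product is the exponential of a convergent series, since its
      factors are \<open>exp (- (1/2) * l n)\<close>.\<close>
    have "(\<lambda>n. exp (- (1/2) * l n)) has_prod exp (- (1/2) * suminf l)"
      using sums_imp_has_prod_exp[OF sums_mult[OF summable_sums[OF l_sm], of "- (1/2)"]] by (simp add: has_prod_def)
    moreover have "exp (- (1/2) * l n) = (if prime n \<and> n mod 4 = 3 then (1 - 1 / (real n)^2) powr (-1/2) else 1)" for n
      using sq[OF prime3_ge[of n]] by (auto simp: l_def prime3_def powr_def)
    ultimately have "(\<lambda>k. if prime k \<and> k mod 4 = 3 then (1 - 1 / (real k)^2) powr (-1/2) else 1)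
        has_prod exp (- (1/2) * suminf l)" by simp
    then have "(\<Prod>k. if prime k \<and> k mod 4 = 3 then (1 - 1 / (real k)^2) powr (-1/2) else 1)
        = exp (- (1/2) * suminf l)" by (rule has_prod_unique[symmetric])
    then show ?thesis unfolding LR_beta_def by simp
  qed
  have M: "calM N = 1/2 * exp (- (E N + S N) / 2)" for N
  proof -
    have "(\<Prod>p\<in>{p. prime p \<and> p mod 4 = 3 \<and> p \<le> N}. inverse (1 + 1 / real p))
        = (\<Prod>p\<le>N. exp (- (prime3 p * ln (1 + 1 / p))))"
    proof (rule prod.mono_neutral_cong_left)
      fix p assume "p \<in> {p. prime p \<and> p mod 4 = 3 \<and> p \<le> N}"
      then have "prime3 p = 1" by (simp add: prime3_def)
      moreover have "1 + 1 / real p > 0" by (simp add: add_pos_nonneg)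
      ultimately show "inverse (1 + 1 / real p) = exp (- (prime3 p * ln (1 + 1 / p)))"
        by (metis exp_minus mult_1 exp_ln)
    qed (auto simp: prime3_def)
    also have "\<dots> = exp (\<Sum>p\<le>N. - (prime3 p * ln (1 + 1 / p)))" by (simp add: exp_sum)
    also have "(\<Sum>p\<le>N. - (prime3 p * ln (1 + 1 / p))) = - (E N + S N) / 2"
      unfolding E_def S_def l_eq sum.distrib[symmetric] sum_negf[symmetric] sum_divide_distrib
      by (intro sum.cong) (auto simp: algebra_simps)
    finally show ?thesis unfolding calM_def by simp
  qed
  \<comment> \<open>The factor \<open>sqrt (ln N)\<close> becomes
    \<open>exp (ln (ln N) / 2)\<close>, which supplies exactly the term that makes
    \<open>E N\<close> converge.\<close>
  have eq: "calM N / calL N = sqrt 2 / 2 * exp (- ((E N - ln (ln N)) + (S N - suminf l)) / 2)" if "N \<ge> 3" for N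
  proof -
    have "ln (real N) > 0" using that by simp
    then have s: "sqrt (ln N) = exp (ln (ln N) / 2)" using powr_half_sqrt[of "ln N"] by (simp add: powr_def)
    have "calM N / calL N = sqrt 2 / 2 * (exp (- (E N + S N) / 2) * exp (ln (ln N) / 2) / exp (- suminf l / 2))"
      unfolding M calL_def beta s by (simp add: field_simps)
    also have "exp (- (E N + S N) / 2) * exp (ln (ln N) / 2) / exp (- suminf l / 2)
        = exp (- ((E N - ln (ln N)) + (S N - suminf l)) / 2)"
      by (simp flip: exp_add exp_diff add: diff_divide_distrib add_divide_distrib)
    finally show ?thesis .
  qed
  have "(\<lambda>N. sqrt 2 / 2 * exp (- ((E N - ln (ln N)) + (S N - suminf l)) / 2))
      \<longlonglongrightarrow> sqrt 2 / 2 * exp (- ((euler_mascheroni + ln (2 / pi)) + (suminf l - suminf l)) / 2)"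
    unfolding E_def S_def by (intro tendsto_intros prime3_mertens summable_LIMSEQ' l_sm) auto
  moreover have "\<forall>\<^sub>F N in sequentially. sqrt 2 / 2 * exp (- ((E N - ln (ln N)) + (S N - suminf l)) / 2) = calM N / calL N"
    using eventually_ge_at_top[of 3] by eventually_elim (simp only: eq)
  ultimately have lim: "(\<lambda>N. calM N / calL N) \<longlonglongrightarrow>
      sqrt 2 / 2 * exp (- ((euler_mascheroni + ln (2 / pi)) + (suminf l - suminf l)) / 2)"
    by (rule Lim_transform_eventually)
  \<comment> \<open>The \<open>S\<close> part has cancelled against \<open>LR_beta\<close>. The
    remaining exponential is the square root of \<open>pi / exp euler_mascheroni / 2\<close>, whose
    denominator 2 cancels \<open>sqrt 2\<close>.\<close>
  have "sqrt 2 / 2 * exp (- ((euler_mascheroni + ln (2 / pi)) + (suminf l - suminf l)) / 2)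
      = 1/2 * sqrt (pi / exp euler_mascheroni)"
  proof -
    have "exp (- (euler_mascheroni + ln (2 / pi)) / 2) = sqrt (exp (- (euler_mascheroni + ln (2 / pi))))"
      by (rule real_sqrt_unique[symmetric]) (simp_all flip: exp_double)
    also have "exp (- (euler_mascheroni + ln (2 / pi))) = pi / exp euler_mascheroni / 2"
      by (simp add: exp_diff exp_minus exp_add field_simps)
    finally show ?thesis by (simp add: real_sqrt_divide real_sqrt_mult)
  qed
  with lim show ?thesis by (auto simp: convergent_def)
qed

end
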